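(* Let $\alpha>-1$ be real, let $p,q$ be positive integers, and let $\kappa(z)=\frac{z}{(1-z)^2}$, $z\in\Delta$, be the Koebe function. Then $$\|S_{\kappa}^{[p,q]}\|_{\mathbf{M}_{\alpha,\alpha+2p+2q}}=\sqrt{\mathcal{N}_{\alpha,p,q}},$$ where $$\mathcal{N}_{\alpha,p,q}=\frac{[(p+q-1)!]^2}{2^{2p+2q}}\,\frac{\Gamma(\alpha+2+2p+2q)}{\Gamma(\alpha+2)}\left[\frac{\Gamma(\alpha/2+1)}{\Gamma(\alpha/2+1+p+q)}\right]^2$$ and $\Gamma$ is the Gamma function.
   Context: $\Delta=\{z\in\mathbb{C}:|z|<1\}$ is the unit disk and $\mathcal{A}(\Delta)$ is the class of analytic functions in $\Delta$. For $\alpha>-1$ the weighted Bergman space is $\mathbf{A}_\alpha^2=\{\phi\in\mathcal{A}(\Delta):\|\phi\|_\alpha^2:=(\alpha+1)\iint_\Delta|\phi(z)|^2(1-|z|^2)^\alpha\frac{dx\,dy}{\pi}<\infty\}$. For $\beta>\alpha>-1$ and $g\in\mathcal{A}(\Delta)$ such that multiplication $\phi\mapsto g\phi$ is bounded from $\mathbf{A}_\alpha^2$ to $\mathbf{A}_\beta^2$ (such $g$ is called a multiplier), the multiplier norm is $\|g\|_{\mathbf{M}_{\alpha,\beta}}:=\sup_{\phi\in\mathbf{A}_\alpha^2,\ \phi\ne0}\frac{\|g\phi\|_\beta}{\|\phi\|_\alpha}$. $\mathcal{S}$ is the class of univalent (injective analytic) functions $f$ in $\Delta$ with $f(0)=0$,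 $f'(0)=1$. For $f\in\mathcal{S}$ define $F$ on $\Delta^2$ by $F(z,w)=\log\left(\frac{f(z)-f(w)}{z-w}\cdot\frac{z}{f(z)}\cdot\frac{w}{f(w)}\right)$ if $z\ne w$, and $F(z,z)=\log\left(f'(z)\frac{z^2}{[f(z)]^2}\right)$, where $z/f(z)$ is taken to be $1$ at $z=0$ and the logarithm is the analytic branch on $\Delta^2$ with $F(0,0)=0$. For positive integers $p,q$ put $G_f^{[p,q]}(z,w)=\frac{\partial^{p+q}F}{\partial z^p\partial w^q}(z,w)$ and define the higher-order Schwarzian derivative $S_f^{[p,q]}(z)=G_f^{[p,q]}(z,z)$, $z\in\Delta$. The Koebe function $\kappa$ belongs to $\mathcal{S}$. *)

theory Defs
  imports "HOL-Complex_Analysis.Complex_Analysis"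
begin

abbreviation unit_disk :: "complex set" where
  "unit_disk \<equiv> ball 0 1"

section \<open>Weighted Bergman spaces and multipliers\<close>

text \<open>
  Functions on the disk are represented by total functions on the complex plane; their values
  outside the disk are irrelevant. The measure \<open>lborel\<close> on the type \<^typ>\<open>complex\<close> is the area measure
  \<open>dx dy\<close>.
\<close>

definition bergman_space :: "real \<Rightarrow> (complex \<Rightarrow> complex) set" where
  "bergman_space \<alpha> = {\<phi>. \<phi> holomorphic_on unit_disk \<and>
     set_integrable lborel unit_disk (\<lambda>z. (norm (\<phi> z))\<^sup>2 * (1 - (norm z)\<^sup>2) powr \<alpha>)}"

definition bergman_norm :: "real \<Rightarrow> (complex \<Rightarrow> complex) \<Rightarrow> real" where
  "bergman_norm \<alpha> \<phi> = sqrt ((\<alpha> + 1) *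
     (LINT z:unit_disk|lborel. (norm (\<phi> z))\<^sup>2 * (1 - (norm z)\<^sup>2) powr \<alpha> / pi))"

definition multiplier :: "real \<Rightarrow> real \<Rightarrow> (complex \<Rightarrow> complex) \<Rightarrow> bool" where
  "multiplier \<alpha> \<beta> g \<longleftrightarrow> g holomorphic_on unit_disk \<and>
     (\<exists>C. \<forall>\<phi>\<in>bergman_space \<alpha>. (\<lambda>z. g z * \<phi> z) \<in> bergman_space \<beta> \<and>
        bergman_norm \<beta> (\<lambda>z. g z * \<phi> z) \<le> C * bergman_norm \<alpha> \<phi>)"

text \<open>
  The supremum below is one of real numbers, so it is meaningful only when \<open>multiplier \<alpha> \<beta> g\<close> holds.
  The condition \<open>\<phi> \<noteq> 0\<close> is read on the disk.
\<close>

definition multiplier_norm :: "real \<Rightarrow> real \<Rightarrow> (complex \<Rightarrow> complex) \<Rightarrow> real" where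
  "multiplier_norm \<alpha> \<beta> g =
     (SUP \<phi>\<in>{\<phi>\<in>bergman_space \<alpha>. \<exists>z\<in>unit_disk. \<phi> z \<noteq> 0}.
        bergman_norm \<beta> (\<lambda>z. g z * \<phi> z) / bergman_norm \<alpha> \<phi>)"

section \<open>Higher-order Schwarzian derivatives\<close>

definition class_S :: "(complex \<Rightarrow> complex) set" where
  "class_S = {f. f holomorphic_on unit_disk \<and> inj_on f unit_disk \<and> f 0 = 0 \<and> deriv f 0 = 1}"

definition id_quotient :: "(complex \<Rightarrow> complex) \<Rightarrow> complex \<Rightarrow> complex" where
  "id_quotient f z = (if z = 0 then 1 else z / f z)"

definition log_argument :: "(complex \<Rightarrow> complex) \<Rightarrow> complex \<Rightarrow> complex \<Rightarrow> complex" where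
  "log_argument f z w =
     (if z = w then deriv f z * (id_quotient f z)\<^sup>2
      else (f z - f w) / (z - w) * id_quotient f z * id_quotient f w)"

text \<open>
  Analyticity in two variables is expressed as joint continuity together with holomorphy in each
  variable separately (equivalent to the power series definition by Osgood's lemma).
\<close>

definition analytic_on_bidisk :: "(complex \<Rightarrow> complex \<Rightarrow> complex) \<Rightarrow> bool" where
  "analytic_on_bidisk F \<longleftrightarrow>
     continuous_on (unit_disk \<times> unit_disk) (\<lambda>(z, w). F z w) \<and>
     (\<forall>w\<in>unit_disk. (\<lambda>z. F z w) holomorphic_on unit_disk) \<and>
     (\<forall>z\<in>unit_disk. (\<lambda>w. F z w) holomorphic_on unit_disk)"

definition is_log_branch ::
    "(complex \<Rightarrow> complex) \<Rightarrow> (complex \<Rightarrow> complex \<Rightarrow> complex) \<Rightarrow> bool" where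
  "is_log_branch f F \<longleftrightarrow> analytic_on_bidisk F \<and> F 0 0 = 0 \<and>
     (\<forall>z\<in>unit_disk. \<forall>w\<in>unit_disk. exp (F z w) = log_argument f z w)"

text \<open>
  For \<open>f\<close> in \<open>class_S\<close> the branch exists and is unique on the bidisk, so the choice only affects
  values outside the bidisk, on which the derivatives at points of the bidisk do not depend.
\<close>

definition log_branch :: "(complex \<Rightarrow> complex) \<Rightarrow> complex \<Rightarrow> complex \<Rightarrow> complex" where
  "log_branch f = (SOME F. is_log_branch f F)"

definition G_deriv ::
    "nat \<Rightarrow> nat \<Rightarrow> (complex \<Rightarrow> complex) \<Rightarrow> complex \<Rightarrow> complex \<Rightarrow> complex" where
  "G_deriv p q f z w =
     (deriv ^^ p) (\<lambda>\<zeta>. (deriv ^^ q) (\<lambda>\<omega>. log_branch f \<zeta> \<omega>) w) z"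

definition higher_schwarzian :: "nat \<Rightarrow> nat \<Rightarrow> (complex \<Rightarrow> complex) \<Rightarrow> complex \<Rightarrow> complex" where
  "higher_schwarzian p q f z = G_deriv p q f z z"

definition koebe :: "complex \<Rightarrow> complex" where
  "koebe z = z / (1 - z)\<^sup>2"

lemma koebe_class_S: "koebe \<in> class_S"
proof -
  have ne: "1 - z \<noteq> 0" if "z \<in> unit_disk" for z :: complex
    using that by auto
  have hol: "koebe holomorphic_on unit_disk"
    unfolding koebe_def [abs_def] using ne by (intro holomorphic_intros) auto
  have inj: "inj_on koebe unit_disk"
  proof (rule inj_onI)
    fix z w assume z: "z \<in> unit_disk" and w: "w \<in> unit_disk" and eq: "koebe z = koebe w"
    from eq have "z * (1 - w)\<^sup>2 = w * (1 - z)\<^sup>2"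
      using ne [OF z] ne [OF w] by (simp add: koebe_def field_simps)
    then have "(z - w) * (1 - z * w) = 0"
      by (simp add: power2_eq_square algebra_simps)
    moreover have "norm (z * w) < 1"
    proof -
      have "norm z * norm w \<le> norm z * 1"
        using w by (intro mult_left_mono) auto
      then show ?thesis using z by (simp add: norm_mult)
    qed
    then have "z * w \<noteq> 1" by auto
    ultimately show "z = w" by auto
  qed
  have "(koebe has_field_derivative 1) (at 0)"
    unfolding koebe_def [abs_def] by (auto intro!: derivative_eq_intros)
  then have "deriv koebe 0 = 1" by (rule DERIV_imp_deriv)
  with hol inj show ?thesis by (simp add: class_S_def koebe_def)
qed

end

theory Submission
  imports Defs
begin

text \<open>
  For the Koebe function the quotient under the logarithm collapses to \<open>1 - z w\<close>, so
  \<open>F(z, w) = Ln (1 - z w)\<close>. Differentiating and putting \<open>w = z\<close> gives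
  \<open>S(z) = - P(z) / (1 - z\<^sup>2)^k\<close> with \<open>k = p + q\<close> and a polynomial \<open>P\<close> with nonnegative
  coefficients that sum to \<open>Q = (k - 1)!\<close> (\<open>higher_schwarzian_koebe\<close>). Therefore
  \<open>norm (P z) \<le> Q\<close> on the disk, with equality at the points \<open>z = 1\<close> and \<open>z = -1\<close>. The
  theorem thus splits into the computation of the sharp constant for multiplication by
  \<open>1 / (1 - z\<^sup>2)^k\<close>, and the observation that the extremal sequence for it concentrates at these
  two points, where the factor \<open>P\<close> loses nothing.

  The poles of \<open>1 / (1 - z\<^sup>2)\<close> become harmless in the strip \<open>\<bar>Im \<zeta>\<bar> < pi / 2\<close>, which
  \<open>\<zeta> \<mapsto> (exp \<zeta> - 1) / (exp \<zeta> + 1)\<close> maps conformally onto the disk. Under this map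
  \<open>1 - norm z ^ 2 = cos \<theta> * norm (1 - z\<^sup>2)\<close> with \<open>\<theta> = Im \<zeta>\<close>, and the derivative of the map is
  \<open>(1 - z\<^sup>2) / 2\<close>. Hence, up to the factor \<open>1/4\<close>, the norm integral of \<open>\<phi>\<close> with exponent \<open>a\<close>
  is the integral of \<open>norm \<psi> ^ 2 * cos \<theta> powr a\<close> over the strip, where
  \<open>\<psi> = \<phi> (1 - z\<^sup>2)^((a+2)/2)\<close>; and replacing \<open>\<phi>\<close> by \<open>\<phi> / (1 - z\<^sup>2)\<close> and \<open>a\<close> by
  \<open>a + 2\<close> leaves \<open>\<psi>\<close> unchanged. So only the weights \<open>cos \<theta> powr a\<close> and
  \<open>cos \<theta> powr (a + 2)\<close> have to be compared.

  The comparison uses that \<open>norm \<psi> ^ 2\<close> is subharmonic. With \<open>w = cos \<theta> powr (a + 2)\<close> one has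
  \<open>w'' = (a + 2) * ((a + 1) * cos \<theta> powr a - (a + 2) * cos \<theta> powr (a + 2))\<close>, and Green's identity
  moves the Laplacian from \<open>w\<close> to \<open>norm \<psi> ^ 2\<close>, where it is nonnegative. This yields the factor
  \<open>(a + 1) / (a + 2)\<close> (\<open>strip_weight_comparison\<close>). Together with the normalising constants of the
  Bergman norms one division by \<open>1 - z\<^sup>2\<close> costs \<open>(a + 3) / (a + 2)\<close>, and the product of these
  numbers over \<open>a = \<alpha>, \<alpha> + 2, \<dots>, \<alpha> + 2 (k - 1)\<close> is the quotient of Gamma values in the claim
  (\<open>Gamma_quotient_eq_prod\<close>).

  The constant is sharp because constant \<open>\<psi>\<close> would give equality. A constant is not square
  integrable over the infinite strip, so one takes \<open>\<psi> = (1 - z\<^sup>2) powr e\<close>, which has modulus about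
  \<open>exp (- e \<bar>Re \<zeta>\<bar>)\<close>, and lets \<open>e\<close> tend to \<open>0\<close>. The mass then escapes to the two ends of the
  strip, that is to \<open>z = 1\<close> and \<open>z = -1\<close> (\<open>multiplier_constant_lower_bound\<close>).
\<close>

section \<open>Change of variables under injective holomorphic maps\<close>

(* Frees the dollar sign for vector components. *)
unbundle no fps_syntax

text \<open>
  The change of variables theorem for several variables speaks about vectors \<open>real^'n\<close>. This
  identification carries it over to the complex plane.
\<close>

definition complex_of_vec :: "real^2 \<Rightarrow> complex" where
  "complex_of_vec x = Complex (x $ 1) (x $ 2)"

lemma lborel_eq_distr_complex_of_vec:
  "(lborel :: complex measure) = distr lborel borel complex_of_vec"
  unfolding complex_of_vec_def [abs_def]
proof (rule lborel_eqI)
  fix l u :: complex assume le: "\<And>b. b \<in> Basis \<Longrightarrow> l \<bullet> b \<le> u \<bullet> b"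
  have [measurable]: "(\<lambda>x::real^2. Complex (x $ 1) (x $ 2)) \<in> borel \<rightarrow>\<^sub>M borel"
    by (intro borel_measurable_continuous_onI continuous_intros)
  let ?l = "vector [Re l, Im l] :: real^2" and ?u = "vector [Re u, Im u] :: real^2"
  have eq: "(\<lambda>x::real^2. Complex (x $ 1) (x $ 2)) -` box l u = box ?l ?u"
    by (auto simp: box_def Basis_complex_def Basis_vec_def inner_axis forall_2)
  have "Re l \<le> Re u" "Im l \<le> Im u"
    using le[of 1] le[of \<i>] by (auto simp: Basis_complex_def)
  moreover have B: "(Basis :: (real^2) set) = {axis 1 1, axis 2 1}"
    by (auto simp: Basis_vec_def exhaust_2 UNIV_2)
  moreover have ne: "axis 1 1 \<noteq> (axis 2 1 :: real^2)"
    by (simp add: axis_eq_axis)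
  ultimately show "emeasure (distr lborel borel (\<lambda>x::real^2. Complex (x $ 1) (x $ 2))) (box l u) =
      ennreal (\<Prod>b\<in>Basis. (u - l) \<bullet> b)"
    by (simp add: emeasure_distr eq emeasure_lborel_box_eq Basis_complex_def B inner_axis)
qed simp

lemma lborel_complex_eq_prod:
  "(lborel :: complex measure) = distr (lborel \<Otimes>\<^sub>M lborel) borel (\<lambda>(x, y). Complex x y)"
proof (rule lborel_eqI)
  fix l u :: complex assume le: "\<And>b. b \<in> Basis \<Longrightarrow> l \<bullet> b \<le> u \<bullet> b"
  have [measurable]: "(\<lambda>(x, y). Complex x y) \<in> borel \<rightarrow>\<^sub>M borel"
    by (intro borel_measurable_continuous_onI) (auto simp: split_beta intro!: continuous_intros)
  have eq: "(\<lambda>(x, y). Complex x y) -` box l u = box (Re l, Im l) (Re u, Im u)"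
    by (auto simp: box_def Basis_complex_def Basis_prod_def)
  have "Re l \<le> Re u" "Im l \<le> Im u"
    using le[of 1] le[of \<i>] by (auto simp: Basis_complex_def)
  then show "emeasure (distr (lborel \<Otimes>\<^sub>M lborel) borel (\<lambda>(x, y). Complex x y)) (box l u) =
      ennreal (\<Prod>b\<in>Basis. (u - l) \<bullet> b)"
    unfolding lborel_prod
    by (simp add: emeasure_distr eq emeasure_lborel_box_eq Basis_complex_def Basis_prod_def)
qed simp

lemma set_integral_complex_of_vec:
  fixes f :: "complex \<Rightarrow> real" and A :: "complex set"
  assumes "open A" and "continuous_on A f"
  shows "set_integrable lborel A f \<longleftrightarrow> (\<lambda>x. f (complex_of_vec x)) absolutely_integrable_on (complex_of_vec -` A)"
    and "set_integrable lborel A f \<Longrightarrow> (LINT z:A|lborel. f z) = integral (complex_of_vec -` A) (\<lambda>x. f (complex_of_vec x))"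
proof -
  have T [measurable]: "complex_of_vec \<in> borel \<rightarrow>\<^sub>M borel"
    unfolding complex_of_vec_def[abs_def] by (intro borel_measurable_continuous_onI continuous_intros)
  have A [measurable]: "A \<in> sets borel" using assms by auto
  have f [measurable]: "(\<lambda>z. indicator A z *\<^sub>R f z) \<in> borel_measurable borel"
    using borel_measurable_continuous_on_indicator[OF A assms(2)] by simp
  have eq: "(\<lambda>x. indicator A (complex_of_vec x) *\<^sub>R f (complex_of_vec x)) = (\<lambda>x. indicator (complex_of_vec -` A) x *\<^sub>R f (complex_of_vec x))"
    by (auto simp: indicator_def fun_eq_iff)
  have m: "(\<lambda>x. indicator (complex_of_vec -` A) x *\<^sub>R f (complex_of_vec x)) \<in> borel_measurable lborel"
    using measurable_compose[OF T f] unfolding eq by simp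
  have L: "(lborel :: complex measure) = distr lborel borel complex_of_vec"
    by (rule lborel_eq_distr_complex_of_vec)
  have 1: "set_integrable lborel A f \<longleftrightarrow> set_integrable lborel (complex_of_vec -` A) (\<lambda>x. f (complex_of_vec x))"
    unfolding set_integrable_def L eq[symmetric] by (rule integrable_distr_eq) (use T f in simp_all)
  also have "\<dots> \<longleftrightarrow> (\<lambda>x. f (complex_of_vec x)) absolutely_integrable_on (complex_of_vec -` A)"
    unfolding set_integrable_def by (rule integrable_completion[symmetric]) (rule m)
  finally show "set_integrable lborel A f \<longleftrightarrow> (\<lambda>x. f (complex_of_vec x)) absolutely_integrable_on (complex_of_vec -` A)" .
  assume "set_integrable lborel A f"
  then have "set_integrable lborel (complex_of_vec -` A) (\<lambda>x. f (complex_of_vec x))" using 1 by simp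
  moreover have "(LINT z:A|lborel. f z) = (LINT x:(complex_of_vec -` A)|lborel. f (complex_of_vec x))"
    unfolding set_lebesgue_integral_def L eq[symmetric] by (rule integral_distr) (use T f in simp_all)
  ultimately show "(LINT z:A|lborel. f z) = integral (complex_of_vec -` A) (\<lambda>x. f (complex_of_vec x))"
    using set_borel_integral_eq_integral(2) by metis
qed

text \<open>
  Multiplication by the complex number \<open>c = deriv g z\<close> is a rotation combined with a scaling by
  \<open>norm c\<close>; as a real \<open>2 \<times> 2\<close> matrix it has determinant \<open>(norm c)\<^sup>2\<close>.
\<close>

lemma holomorphic_change_of_variables:
  fixes f :: "complex \<Rightarrow> real" and g :: "complex \<Rightarrow> complex"
  assumes "open S" and hol: "g holomorphic_on S" and inj: "inj_on g S"
    and f: "continuous_on (g ` S) f"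
  shows "set_integrable lborel (g ` S) f \<longleftrightarrow> set_integrable lborel S (\<lambda>z. (norm (deriv g z))\<^sup>2 * f (g z))"
    and "set_integrable lborel (g ` S) f \<Longrightarrow>
      (LINT z:g ` S|lborel. f z) = (LINT z:S|lborel. (norm (deriv g z))\<^sup>2 * f (g z))"
proof -
  define T where "T = complex_of_vec"
  define T' where "T' = (\<lambda>z. vector [Re z, Im z] :: real^2)"
  have TT' [simp]: "T (T' z) = z" for z by (simp add: T_def complex_of_vec_def T'_def)
  have T'T [simp]: "T' (T x) = x" for x by (simp add: T_def complex_of_vec_def T'_def vec_eq_iff forall_2)
  have lT: "bounded_linear T"
    unfolding linear_conv_bounded_linear[symmetric]
    by (rule linearI) (auto simp: T_def complex_of_vec_def complex_eq_iff)
  have lT': "bounded_linear T'"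
    unfolding linear_conv_bounded_linear[symmetric]
    by (rule linearI) (auto simp: T'_def vec_eq_iff forall_2)
  have opS: "open (g ` S)"
    by (rule open_mapping_thm3[OF hol \<open>open S\<close> inj])
  have oT: "open (T -` S)"
    using \<open>open S\<close> by (intro open_vimage linear_continuous_on lT)
  have "continuous_on S (deriv g)"
    using hol \<open>open S\<close> by (intro holomorphic_on_imp_continuous_on holomorphic_deriv)
  moreover have "continuous_on S (\<lambda>z. f (g z))"
    by (rule continuous_on_compose2[OF f]) (use hol holomorphic_on_imp_continuous_on in auto)
  ultimately have cont: "continuous_on S (\<lambda>z. (norm (deriv g z))\<^sup>2 * f (g z))"
    by (intro continuous_intros)
  define G where "G = (\<lambda>x. T' (g (T x)))"
  define G' where "G' = (\<lambda>x h. T' (deriv g (T x) * T h))"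
  have der: "(G has_derivative G' x) (at x within T -` S)" if "x \<in> T -` S" for x
  proof -
    have "(g has_field_derivative deriv g (T x)) (at (T x))"
      using that hol \<open>open S\<close> holomorphic_derivI by auto
    then have "(g has_derivative (\<lambda>h. deriv g (T x) * h)) (at (T x))"
      by (simp add: has_field_derivative_def)
    moreover have "(T has_derivative T) (at x)" by (rule bounded_linear_imp_has_derivative[OF lT])
    ultimately have "((\<lambda>y. g (T y)) has_derivative (\<lambda>h. deriv g (T x) * T h)) (at x)"
      using has_derivative_compose by blast
    then have "(G has_derivative G' x) (at x)"
      unfolding G_def G'_def by (rule bounded_linear.has_derivative[OF lT'])
    then show ?thesis by (rule has_derivative_at_withinI)
  qed
  have G_inj: "inj_on G (T -` S)"
  proof (rule inj_onI)
    fix x y assume "x \<in> T -` S" "y \<in> T -` S" "G x = G y"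
    then have "g (T x) = g (T y)" unfolding G_def by (metis TT')
    then have "T x = T y" using inj \<open>x \<in> _\<close> \<open>y \<in> _\<close> by (auto dest: inj_onD)
    then show "x = y" by (metis T'T)
  qed
  have det: "det (matrix (G' x)) = (norm (deriv g (T x)))\<^sup>2" for x
  proof -
    have "matrix (G' x) $ 1 $ 1 = Re (deriv g (T x))" "matrix (G' x) $ 2 $ 1 = Im (deriv g (T x))"
      "matrix (G' x) $ 1 $ 2 = - Im (deriv g (T x))" "matrix (G' x) $ 2 $ 2 = Re (deriv g (T x))"
      by (auto simp: matrix_def G'_def T_def complex_of_vec_def T'_def axis_def)
    then show ?thesis
      by (simp add: det_2 cmod_power2) (simp add: power2_eq_square)
  qed
  have img: "G ` (T -` S) = T -` (g ` S)"
  proof (intro equalityI subsetI)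
    fix x assume "x \<in> T -` (g ` S)"
    then obtain z where "z \<in> S" "T x = g z" by auto
    then have "x = G (T' z)" "T' z \<in> T -` S" unfolding G_def using T'T[of x] by auto
    then show "x \<in> G ` (T -` S)" by blast
  qed (auto simp: G_def)
  have TG: "T (G x) = g (T x)" for x by (simp add: G_def)
  have key: "(\<lambda>x. \<bar>det (matrix (G' x))\<bar> *\<^sub>R f (T (G x))) absolutely_integrable_on (T -` S) \<and>
           integral (T -` S) (\<lambda>x. \<bar>det (matrix (G' x))\<bar> *\<^sub>R f (T (G x))) = b
     \<longleftrightarrow> (\<lambda>x. f (T x)) absolutely_integrable_on (G ` (T -` S)) \<and> integral (G ` (T -` S)) (\<lambda>x. f (T x)) = b" for b
    using has_absolute_integral_change_of_variables[of "T -` S" G G' "\<lambda>x. vec (f (T x)) :: real^1" "vec b"]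
      oT der G_inj
    by (simp add: absolutely_integrable_on_1_iff integral_on_1_eq vec_eq_iff lmeasurable_open)
  have key': "(\<lambda>x. (norm (deriv g (T x)))\<^sup>2 * f (g (T x))) absolutely_integrable_on (T -` S) \<and>
           integral (T -` S) (\<lambda>x. (norm (deriv g (T x)))\<^sup>2 * f (g (T x))) = b
     \<longleftrightarrow> (\<lambda>x. f (T x)) absolutely_integrable_on (T -` (g ` S)) \<and> integral (T -` (g ` S)) (\<lambda>x. f (T x)) = b" for b
    using key[of b] unfolding det TG img by simp
  note A = set_integral_complex_of_vec[OF opS f, folded T_def]
  note B = set_integral_complex_of_vec[OF \<open>open S\<close> cont, folded T_def]
  show iff: "set_integrable lborel (g ` S) f \<longleftrightarrow> set_integrable lborel S (\<lambda>z. (norm (deriv g z))\<^sup>2 * f (g z))"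
    unfolding A(1) B(1) using key' by blast
  assume int: "set_integrable lborel (g ` S) f"
  have "integral (T -` S) (\<lambda>x. (norm (deriv g (T x)))\<^sup>2 * f (g (T x))) = integral (T -` (g ` S)) (\<lambda>x. f (T x))"
    using key' int A(1) by blast
  then show "(LINT z:g ` S|lborel. f z) = (LINT z:S|lborel. (norm (deriv g z))\<^sup>2 * f (g z))"
    using A(2)[OF int] B(2) int iff by simp
qed

section \<open>The higher-order Schwarzian derivatives of the Koebe function\<close>

lemma one_minus_mult_disk_nonzero:
  fixes z w :: complex
  assumes "z \<in> unit_disk" "w \<in> unit_disk"
  shows "Re (1 - z * w) > 0" and "1 - z * w \<noteq> 0"
proof -
  have "norm z * norm w \<le> norm z * 1"
    using assms by (intro mult_left_mono) auto
  then have "norm (z * w) < 1" using assms by (simp add: norm_mult)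
  then have "Re (z * w) < 1" using complex_Re_le_cmod[of "z * w"] by linarith
  then show re: "Re (1 - z * w) > 0" by simp
  show "1 - z * w \<noteq> 0"
  proof
    assume "1 - z * w = 0"
    then have "Re (1 - z * w) = 0" by (simp only: zero_complex.sel)
    with re show False by linarith
  qed
qed

lemma log_argument_koebe:
  assumes z: "z \<in> unit_disk" and w: "w \<in> unit_disk"
  shows "log_argument koebe z w = 1 - z * w"
proof -
  have ne: "1 - z \<noteq> 0" "1 - w \<noteq> 0"
    using z w by auto
  have idq: "id_quotient koebe u = (1 - u)\<^sup>2" for u
    by (auto simp: id_quotient_def koebe_def)
  have "(koebe has_field_derivative (1 + z) / (1 - z) ^ 3) (at z)"
    unfolding koebe_def [abs_def] using ne(1)
    by (auto intro!: derivative_eq_intros simp: divide_simps) algebra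
  then have d: "deriv koebe z = (1 + z) / (1 - z) ^ 3" by (rule DERIV_imp_deriv)
  show ?thesis
  proof (cases "z = w")
    case True
    have "deriv koebe z * ((1 - z)\<^sup>2)\<^sup>2 = (1 + z) * (1 - z)"
    proof -
      have "a / u ^ 3 * (u\<^sup>2)\<^sup>2 = a * u" if "u \<noteq> 0" for a u :: complex
        using that by (simp add: field_simps power2_eq_square power3_eq_cube)
      from this[OF ne(1)] show ?thesis unfolding d .
    qed
    then show ?thesis using True by (simp add: log_argument_def idq) (simp add: algebra_simps)
  next
    case False
    have "koebe z - koebe w = (z - w) * (1 - z * w) / ((1 - z)\<^sup>2 * (1 - w)\<^sup>2)"
      using ne by (simp add: koebe_def divide_simps) (simp add: algebra_simps power2_eq_square)
    then show ?thesis using False ne by (simp add: log_argument_def idq)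
  qed
qed

text \<open>
  Two logarithms of the same function differ by such an \<open>h\<close>. This gives the uniqueness of the
  branch without a topological argument: \<open>h' exp h\<close> vanishes, hence so does \<open>h'\<close>.
\<close>

lemma holomorphic_exp_eq_1_constant:
  assumes hol: "h holomorphic_on unit_disk" and exp: "\<And>z. z \<in> unit_disk \<Longrightarrow> exp (h z) = 1"
    and z: "z \<in> unit_disk"
  shows "h z = h 0"
proof -
  have "(h has_field_derivative 0) (at x within unit_disk)" if x: "x \<in> unit_disk" for x
  proof -
    have d: "(h has_field_derivative deriv h x) (at x)"
      using hol x by (simp add: holomorphic_derivI)
    have "((\<lambda>z. exp (h z)) has_field_derivative exp (h x) * deriv h x) (at x)"
      using d by (auto intro!: derivative_eq_intros)
    moreover have "((\<lambda>z. exp (h z)) has_field_derivative 0) (at x)"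
      by (rule has_field_derivative_transform_within_open[of "\<lambda>_. 1" _ _ unit_disk])
         (use x exp in auto)
    ultimately have "exp (h x) * deriv h x = 0" by (rule DERIV_unique)
    then have "(h has_field_derivative 0) (at x)" using d by simp
    then show ?thesis by (rule has_field_derivative_at_within)
  qed
  then obtain c where "\<forall>x\<in>unit_disk. h x = c"
    using has_field_derivative_zero_constant[of unit_disk h] by auto
  then show ?thesis using z by simp
qed

text \<open>
  The principal logarithm is an admissible branch because \<open>1 - z w\<close> has positive real part.
  Uniqueness is needed since \<open>log_branch\<close> is an arbitrary choice; it is obtained by moving from
  \<open>(0, 0)\<close> to \<open>(z, 0)\<close> and then to \<open>(z, w)\<close>, one variable at a time.
\<close>

lemma log_branch_koebe:
  assumes z: "z \<in> unit_disk" and w: "w \<in> unit_disk"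
  shows "log_branch koebe z w = Ln (1 - z * w)"
proof -
  have slit: "1 - z * w \<notin> \<real>\<^sub>\<le>\<^sub>0" if "z \<in> unit_disk" "w \<in> unit_disk" for z w :: complex
    using one_minus_mult_disk_nonzero(1)[OF that] by (auto simp: complex_nonpos_Reals_iff)
  have "is_log_branch koebe (\<lambda>z w. Ln (1 - z * w))"
    unfolding is_log_branch_def analytic_on_bidisk_def
  proof (intro conjI ballI)
    show "continuous_on (unit_disk \<times> unit_disk) (\<lambda>(z, w). Ln (1 - z * w :: complex))"
      unfolding split_beta using slit by (intro continuous_intros) auto
  qed (use slit one_minus_mult_disk_nonzero(2) in
        \<open>auto intro!: holomorphic_intros simp: log_argument_koebe\<close>)
  then have "is_log_branch koebe (log_branch koebe)"
    unfolding log_branch_def by (metis someI)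
  then have F: "(\<lambda>z. log_branch koebe z w) holomorphic_on unit_disk"
      "(\<lambda>w. log_branch koebe z w) holomorphic_on unit_disk" "log_branch koebe 0 0 = 0"
      "exp (log_branch koebe z w) = 1 - z * w"
    if "z \<in> unit_disk" "w \<in> unit_disk" for z w
    using that unfolding is_log_branch_def analytic_on_bidisk_def by (auto simp: log_argument_koebe)
  have "log_branch koebe z 0 = log_branch koebe 0 0"
    by (rule holomorphic_exp_eq_1_constant[OF F(1)]) (use z F(4) in auto)
  moreover have "log_branch koebe z w - Ln (1 - z * w) = log_branch koebe z 0 - Ln (1 - z * 0)"
  proof (rule holomorphic_exp_eq_1_constant[of "\<lambda>w. log_branch koebe z w - Ln (1 - z * w)"])
    show "(\<lambda>w. log_branch koebe z w - Ln (1 - z * w)) holomorphic_on unit_disk"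
      using slit z F(2) by (intro holomorphic_intros) auto
  qed (use z w F(4) one_minus_mult_disk_nonzero(2) in \<open>auto simp: exp_diff\<close>)
  ultimately show ?thesis using F(3)[OF z w] by simp
qed

lemma higher_deriv_on_open:
  assumes "open S" and "z \<in> S"
    and base: "\<And>z. z \<in> S \<Longrightarrow> f z = F 0 z"
    and step: "\<And>n z. z \<in> S \<Longrightarrow> (F n has_field_derivative F (Suc n) z) (at z)"
  shows "(deriv ^^ n) f z = F n z"
  using \<open>z \<in> S\<close>
proof (induction n arbitrary: z)
  case (Suc n)
  have "eventually (\<lambda>x. (deriv ^^ n) f x = F n x) (nhds z)"
    using Suc \<open>open S\<close> eventually_nhds by blast
  then have "deriv ((deriv ^^ n) f) z = deriv (F n) z" by (intro deriv_cong_ev refl)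
  then show ?case using DERIV_imp_deriv[OF step[OF Suc.prems]] by simp
qed (simp add: base)

lemma has_field_derivative_divide_power:
  fixes N f :: "complex \<Rightarrow> complex"
  assumes "(N has_field_derivative N') (at z)" and "(f has_field_derivative f') (at z)" and "f z \<noteq> 0"
  shows "((\<lambda>z. N z / f z ^ k) has_field_derivative (N' * f z - of_nat k * f' * N z) / f z ^ Suc k) (at z)"
proof (cases k)
  case 0
  then show ?thesis using assms by simp
next
  case (Suc m)
  have "((\<lambda>z. N z / f z ^ Suc m) has_field_derivative
      (N' * f z ^ Suc m - N z * (of_nat (Suc m) * (f' * f z ^ m))) / (f z ^ Suc m * f z ^ Suc m)) (at z)"
    using assms DERIV_power[OF assms(2), of "Suc m"] by (intro DERIV_divide) simp_all
  also have "(N' * f z ^ Suc m - N z * (of_nat (Suc m) * (f' * f z ^ m))) / (f z ^ Suc m * f z ^ Suc m) =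
     (N' * f z - of_nat (Suc m) * f' * N z) / f z ^ Suc (Suc m)"
    using assms(3) by (simp add: divide_simps) (simp add: algebra_simps)
  finally show ?thesis unfolding Suc .
qed

lemma higher_deriv_log_branch_koebe:
  assumes z: "z \<in> unit_disk" and w: "w \<in> unit_disk" and "q \<ge> 1"
  shows "(deriv ^^ q) (log_branch koebe z) w = - fact (q - 1) * (z ^ q / (1 - z * w) ^ q)"
proof -
  define F where "F n w = (if n = 0 then Ln (1 - z * w) else - fact (n - 1) * (z ^ n / (1 - z * w) ^ n))" for n w
  have "(deriv ^^ q) (log_branch koebe z) w = F q w"
  proof (rule higher_deriv_on_open[of unit_disk])
    fix n w assume w: "w \<in> unit_disk"
    have ne: "1 - z * w \<noteq> 0" and re: "Re (1 - z * w) > 0"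
      using one_minus_mult_disk_nonzero[OF z w] by auto
    then have slit: "1 - z * w \<notin> \<real>\<^sub>\<le>\<^sub>0" by (auto simp: complex_nonpos_Reals_iff)
    show "(F n has_field_derivative F (Suc n) w) (at w)"
    proof (cases n)
      case 0
      then show ?thesis unfolding F_def using ne slit
        by (auto intro!: derivative_eq_intros simp: field_simps)
    next
      case (Suc m)
      have "((\<lambda>w. - fact m * (z ^ Suc m / (1 - z * w) ^ Suc m)) has_field_derivative
          - fact (Suc m) * (z ^ Suc (Suc m) / (1 - z * w) ^ Suc (Suc m))) (at w)"
      proof -
        have "((\<lambda>w. 1 - z * w) has_field_derivative - z) (at w)"
          by (auto intro!: derivative_eq_intros)
        from DERIV_cmult[OF has_field_derivative_divide_power[OF DERIV_const this ne], of "- fact m" "z ^ Suc m" "Suc m"]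
        have "((\<lambda>w. - fact m * (z ^ Suc m / (1 - z * w) ^ Suc m)) has_field_derivative
          - fact m * ((0 * (1 - z * w) - of_nat (Suc m) * - z * z ^ Suc m) / (1 - z * w) ^ Suc (Suc m))) (at w)" .
        moreover have "- fact m * ((0 * a - of_nat (Suc m) * - z * z ^ Suc m) / b) = - fact (Suc m) * (z ^ Suc (Suc m) / b)"
          for a b by (simp add: divide_simps)
        ultimately show ?thesis by (simp only:)
      qed
      then show ?thesis unfolding F_def using Suc by simp
    qed
  qed (use z w in \<open>auto simp: F_def log_branch_koebe\<close>)
  then show ?thesis using \<open>q \<ge> 1\<close> by (simp add: F_def)
qed

text \<open>
  One differentiation replaces a term \<open>\<zeta>^m w^n / (1 - \<zeta> w)^l\<close> by
  \<open>(m \<zeta>^(m-1) w^n + (l - m) \<zeta>^m w^(n+1)) / (1 - \<zeta> w)^(l+1)\<close>. Both new coefficients are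
  nonnegative as long as \<open>m \<le> l\<close>, a condition that persists, and they add up to \<open>l\<close>. So the
  coefficients stay nonnegative and their sum is multiplied by \<open>q\<close>, \<open>q + 1\<close>, \<open>\<dots>\<close> in turn.
  Leibniz' rule would give a formula for the derivative in which the signs are not visible.
\<close>

lemma higher_deriv_pole_coeffs:
  "\<exists>c. (\<forall>j. 0 \<le> c j) \<and> (\<forall>j>q. c j = 0) \<and> (\<Sum>j\<le>p. c j) = pochhammer (real q) p \<and>
     (\<forall>z\<in>unit_disk. \<forall>w\<in>unit_disk. (deriv ^^ p) (\<lambda>\<zeta>. \<zeta> ^ q / (1 - \<zeta> * w) ^ q) z =
        (\<Sum>j\<le>p. of_real (c j) * z ^ (q - j) * w ^ (p - j)) / (1 - z * w) ^ (q + p))"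
proof (induction p)
  case 0
  show ?case by (intro exI[of _ "\<lambda>j. if j = 0 then 1 else 0"]) auto
next
  case (Suc p)
  then obtain c where c0: "\<And>j. 0 \<le> c j" and cq: "\<And>j. j > q \<Longrightarrow> c j = 0"
    and cs: "(\<Sum>j\<le>p. c j) = pochhammer (real q) p"
    and cd: "\<And>z w. z \<in> unit_disk \<Longrightarrow> w \<in> unit_disk \<Longrightarrow> (deriv ^^ p) (\<lambda>\<zeta>. \<zeta> ^ q / (1 - \<zeta> * w) ^ q) z =
        (\<Sum>j\<le>p. of_real (c j) * z ^ (q - j) * w ^ (p - j)) / (1 - z * w) ^ (q + p)"
    by blast
  define a where "a j = real (p + j) * c j" for j
  define b where "b j = real (q - j) * c j" for j
  define c' where "c' j = (if j \<le> p then a j else 0) + (if j = 0 then 0 else b (j - 1))" for j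
  have sum_c': "(\<Sum>j\<le>Suc p. of_real (c' j) * h j) = (\<Sum>j\<le>p. of_real (a j) * h j + of_real (b j) * h (Suc j))"
    for h :: "nat \<Rightarrow> 'b::real_field"
  proof -
    have "(\<Sum>j\<le>Suc p. of_real (c' j) * h j) =
        (\<Sum>j\<le>Suc p. of_real (if j \<le> p then a j else 0) * h j) +
        (\<Sum>j\<le>Suc p. of_real (if j = 0 then 0 else b (j - 1)) * h j)"
      unfolding c'_def of_real_add distrib_right sum.distrib ..
    also have "(\<Sum>j\<le>Suc p. of_real (if j \<le> p then a j else 0) * h j) = (\<Sum>j\<le>p. of_real (a j) * h j)"
      by simp
    also have "(\<Sum>j\<le>Suc p. of_real (if j = 0 then 0 else b (j - 1)) * h j) = (\<Sum>j\<le>p. of_real (b j) * h (Suc j))"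
      by (subst sum.atMost_Suc_shift) simp
    finally show ?thesis by (simp add: sum.distrib)
  qed
  have "(\<Sum>j\<le>Suc p. c' j) = (\<Sum>j\<le>p. a j + b j)"
    using sum_c'[of "\<lambda>_. 1 :: real"] by simp
  also have "\<dots> = (\<Sum>j\<le>p. (real q + real p) * c j)"
  proof (rule sum.cong)
    show "a j + b j = (real q + real p) * c j" for j
      using cq[of j] by (cases "j \<le> q") (auto simp: a_def b_def of_nat_diff algebra_simps)
  qed simp
  also have "\<dots> = pochhammer (real q) (Suc p)"
    unfolding sum_distrib_left[symmetric] cs by (simp add: pochhammer_Suc mult.commute)
  finally have s: "(\<Sum>j\<le>Suc p. c' j) = pochhammer (real q) (Suc p)" .
  have d: "(deriv ^^ Suc p) (\<lambda>\<zeta>. \<zeta> ^ q / (1 - \<zeta> * w) ^ q) z =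
        (\<Sum>j\<le>Suc p. of_real (c' j) * z ^ (q - j) * w ^ (Suc p - j)) / (1 - z * w) ^ (q + Suc p)"
    if z: "z \<in> unit_disk" and w: "w \<in> unit_disk" for z w
  proof -
    have ne: "1 - z * w \<noteq> 0" using one_minus_mult_disk_nonzero[OF z w] by auto
    define N where "N z = (\<Sum>j\<le>p. of_real (c j) * z ^ (q - j) * w ^ (p - j))" for z :: complex
    define N' where "N' = (\<Sum>j\<le>p. of_real (c j) * (of_nat (q - j) * z ^ (q - j - 1)) * w ^ (p - j))"
    have dN: "(N has_field_derivative N') (at z)"
      unfolding N_def N'_def by (auto intro!: derivative_eq_intros sum.cong)
    have "((\<lambda>z. N z / (1 - z * w) ^ (q + p)) has_field_derivative
        (N' * (1 - z * w) + of_nat (q + p) * w * N z) / (1 - z * w) ^ (q + Suc p)) (at z)"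
    proof -
      have "((\<lambda>z. 1 - z * w) has_field_derivative - w) (at z)"
        by (auto intro!: derivative_eq_intros)
      from has_field_derivative_divide_power[OF dN this ne, of "q + p"] show ?thesis by simp
    qed
    moreover have "eventually (\<lambda>x. (deriv ^^ p) (\<lambda>\<zeta>. \<zeta> ^ q / (1 - \<zeta> * w) ^ q) x = N x / (1 - x * w) ^ (q + p)) (nhds z)"
      unfolding eventually_nhds N_def using cd z w by (intro exI[of _ unit_disk]) auto
    ultimately have *: "(deriv ^^ Suc p) (\<lambda>\<zeta>. \<zeta> ^ q / (1 - \<zeta> * w) ^ q) z =
        (N' * (1 - z * w) + of_nat (q + p) * w * N z) / (1 - z * w) ^ (q + Suc p)"
      using deriv_cong_ev DERIV_imp_deriv by fastforce
    have "N' * (1 - z * w) + of_nat (q + p) * w * N z = (\<Sum>j\<le>p. of_real (a j) * (z ^ (q - j) * w ^ (Suc p - j))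
        + of_real (b j) * (z ^ (q - Suc j) * w ^ (Suc p - Suc j)))"
      unfolding N'_def N_def sum_distrib_left sum_distrib_right sum.distrib[symmetric]
    proof (rule sum.cong)
      fix j assume "j \<in> {..p}"
      then have wj: "w ^ (Suc p - j) = w * w ^ (p - j)" by (simp add: Suc_diff_le)
      \<comment> \<open>For \<open>j = q\<close> the truncated exponent \<open>q - j - 1\<close> is wrong, but its factor \<open>q - j\<close> is zero;
         for \<open>j > q\<close> the coefficient is zero.\<close>
      show "of_real (c j) * (of_nat (q - j) * z ^ (q - j - 1)) * w ^ (p - j) * (1 - z * w) +
          of_nat (q + p) * w * (of_real (c j) * z ^ (q - j) * w ^ (p - j)) =
          of_real (a j) * (z ^ (q - j) * w ^ (Suc p - j)) + of_real (b j) * (z ^ (q - Suc j) * w ^ (Suc p - Suc j))"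
      proof (cases "j < q")
        case True
        then obtain i where i: "q = Suc (i + j)" by (metis less_imp_Suc_add add.commute)
        show ?thesis unfolding wj by (simp add: i a_def b_def algebra_simps)
      next
        case False
        then consider "j = q" | "c j = 0" using cq[of j] by linarith
        then show ?thesis by cases (use wj in \<open>auto simp: a_def b_def algebra_simps\<close>)
      qed
    qed simp
    also have "\<dots> = (\<Sum>j\<le>Suc p. of_real (c' j) * (z ^ (q - j) * w ^ (Suc p - j)))"
      by (rule sum_c'[symmetric])
    finally show ?thesis unfolding * by (simp add: mult.assoc)
  qed
  show ?case
  proof (intro exI[of _ c'] conjI allI impI ballI)
    show "0 \<le> c' j" for j using c0 by (simp add: c'_def a_def b_def)
    show "c' j = 0" if "j > q" for j using that cq[of j] by (auto simp: c'_def a_def b_def)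
  qed (use s d in auto)
qed

text \<open>
  Nonnegative coefficients make \<open>P\<close> largest at \<open>1\<close>. At \<open>-1\<close> it has the same modulus, because all
  exponents \<open>(q - j) + (p - j)\<close> have the parity of \<open>p + q\<close>.
\<close>

lemma higher_schwarzian_koebe:
  assumes "p \<ge> 1" and "q \<ge> 1"
  obtains P where "P holomorphic_on UNIV"
    and "\<And>z. z \<in> unit_disk \<Longrightarrow> higher_schwarzian p q koebe z = - P z / (1 - z\<^sup>2) ^ (p + q)"
    and "\<And>z. norm z \<le> 1 \<Longrightarrow> norm (P z) \<le> fact (p + q - 1)"
    and "norm (P 1) = fact (p + q - 1)" and "norm (P (-1)) = fact (p + q - 1)"
proof -
  obtain c where c0: "\<And>j. 0 \<le> c j" and cq: "\<And>j. j > q \<Longrightarrow> c j = 0"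
    and cs: "(\<Sum>j\<le>p. c j) = pochhammer (real q) p"
    and cd: "\<And>z w. z \<in> unit_disk \<Longrightarrow> w \<in> unit_disk \<Longrightarrow> (deriv ^^ p) (\<lambda>\<zeta>. \<zeta> ^ q / (1 - \<zeta> * w) ^ q) z =
        (\<Sum>j\<le>p. of_real (c j) * z ^ (q - j) * w ^ (p - j)) / (1 - z * w) ^ (q + p)"
    using higher_deriv_pole_coeffs[of q p] by blast
  define P where "P z = (\<Sum>j\<le>p. of_real (fact (q - 1) * c j) * (z ^ (q - j) * z ^ (p - j)))" for z :: complex
  have total: "(\<Sum>j\<le>p. fact (q - 1) * c j) = fact (p + q - 1)"
  proof -
    obtain m where m: "q = Suc m" using assms by (cases q) auto
    have "(fact (m + p) :: real) = fact m * pochhammer (real (Suc m)) p"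
      by (simp add: pochhammer_fact[of "m + p"] pochhammer_fact[of m] pochhammer_product'[of 1 m p] add.commute)
    then show ?thesis by (simp add: m cs add.commute flip: sum_distrib_left)
  qed
  show thesis
  proof
    show "P holomorphic_on UNIV" unfolding P_def by (intro holomorphic_intros)
    fix z :: complex
    show "higher_schwarzian p q koebe z = - P z / (1 - z\<^sup>2) ^ (p + q)" if z: "z \<in> unit_disk"
    proof -
      have "higher_schwarzian p q koebe z = (deriv ^^ p) (\<lambda>\<zeta>. - fact (q - 1) * (\<zeta> ^ q / (1 - \<zeta> * z) ^ q)) z"
        unfolding higher_schwarzian_def G_deriv_def
      proof (rule higher_deriv_cong_ev)
        show "\<forall>\<^sub>F \<zeta> in nhds z. (deriv ^^ q) (log_branch koebe \<zeta>) z = - fact (q - 1) * (\<zeta> ^ q / (1 - \<zeta> * z) ^ q)"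
          unfolding eventually_nhds using z assms higher_deriv_log_branch_koebe
          by (intro exI[of _ unit_disk]) auto
      qed simp
      also have "\<dots> = - fact (q - 1) * (deriv ^^ p) (\<lambda>\<zeta>. \<zeta> ^ q / (1 - \<zeta> * z) ^ q) z"
      proof (rule higher_deriv_cmult[of _ unit_disk])
        show "(\<lambda>\<zeta>. \<zeta> ^ q / (1 - \<zeta> * z) ^ q) holomorphic_on unit_disk"
          using z one_minus_mult_disk_nonzero(2)[OF _ z] by (intro holomorphic_intros) auto
      qed (use z in auto)
      also have "\<dots> = - P z / (1 - z\<^sup>2) ^ (p + q)"
        unfolding cd[OF z z] P_def by (simp add: sum_distrib_left sum_negf mult_ac power2_eq_square add.commute)
      finally show ?thesis .
    qed
    show "norm (P z) \<le> fact (p + q - 1)" if z: "norm z \<le> 1"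
    proof -
      have "norm (P z) \<le> (\<Sum>j\<le>p. fact (q - 1) * c j)"
        unfolding P_def
      proof (rule sum_norm_le)
        fix j
        have "norm z ^ (q - j) * norm z ^ (p - j) \<le> 1"
          using z by (intro mult_le_one power_le_one) auto
        then show "norm (complex_of_real (fact (q - 1) * c j) * (z ^ (q - j) * z ^ (p - j))) \<le> fact (q - 1) * c j"
          using c0[of j] by (simp add: norm_mult norm_power mult_left_le)
      qed
      then show ?thesis using total by simp
    qed
    have P1: "P 1 = of_real (fact (p + q - 1))"
      unfolding P_def total[symmetric] by simp
    show "norm (P 1) = fact (p + q - 1)" unfolding P1 by simp
    have "P (-1) = (\<Sum>j\<le>p. of_real (fact (q - 1) * c j) * (-1) ^ (q + p))"
      unfolding P_def
    proof (rule sum.cong)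
      fix j assume "j \<in> {..p}"
      show "complex_of_real (fact (q - 1) * c j) * ((- 1) ^ (q - j) * (- 1) ^ (p - j)) =
         complex_of_real (fact (q - 1) * c j) * (- 1) ^ (q + p)"
      proof (cases "j \<le> q")
        case True
        have "(-1) ^ (q + p) = ((-1) ^ (q - j) * (- 1) ^ (p - j) * (- 1) ^ (2 * j) :: complex)"
          unfolding power_add[symmetric] using True \<open>j \<in> {..p}\<close> by (intro arg_cong[where f = "power _"]) auto
        then show ?thesis by simp
      qed (simp add: cq)
    qed simp
    also have "\<dots> = of_real (fact (p + q - 1)) * (-1) ^ (q + p)"
      unfolding total[symmetric] by (simp add: sum_distrib_right)
    finally show "norm (P (-1)) = fact (p + q - 1)" by (simp add: norm_mult norm_power)
  qed
qed

section \<open>Transfer of weighted integrals from the disk to a strip\<close>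

definition strip :: "complex set" where
  "strip = {\<zeta>. \<bar>Im \<zeta>\<bar> < pi / 2}"

definition strip_map :: "complex \<Rightarrow> complex" where
  "strip_map \<zeta> = (exp \<zeta> - 1) / (exp \<zeta> + 1)"

lemma open_strip: "open strip"
  unfolding strip_def by (intro open_Collect_less continuous_intros)

lemma strip_cos_pos: "\<zeta> \<in> strip \<Longrightarrow> cos (Im \<zeta>) > 0"
  unfolding strip_def by (intro cos_gt_zero_pi) auto

lemma strip_Re_exp_pos: "\<zeta> \<in> strip \<Longrightarrow> Re (exp \<zeta>) > 0"
  using strip_cos_pos by (simp add: Re_exp)

lemma strip_exp_plus_1_nonzero:
  assumes "\<zeta> \<in> strip"
  shows "exp \<zeta> + 1 \<noteq> 0"
proof
  assume "exp \<zeta> + 1 = 0"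
  then have "Re (exp \<zeta>) = - 1" by (metis add_eq_0_iff2 one_complex.sel(1) uminus_complex.sel(1))
  then show False using strip_Re_exp_pos[OF assms] by simp
qed

lemma one_minus_strip_map_sq:
  assumes "\<zeta> \<in> strip"
  shows "1 - (strip_map \<zeta>)\<^sup>2 = 4 * exp \<zeta> / (exp \<zeta> + 1)\<^sup>2"
  using strip_exp_plus_1_nonzero[OF assms]
  by (simp add: strip_map_def divide_simps power2_eq_square) (simp add: algebra_simps)

lemma norm_one_minus_strip_map_sq:
  assumes "\<zeta> \<in> strip"
  shows "norm (1 - (strip_map \<zeta>)\<^sup>2) = 4 * exp (Re \<zeta>) / (norm (exp \<zeta> + 1))\<^sup>2"
  unfolding one_minus_strip_map_sq[OF assms] by (simp add: norm_mult norm_divide norm_power)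

lemma has_field_derivative_strip_map:
  assumes "\<zeta> \<in> strip"
  shows "(strip_map has_field_derivative (1 - (strip_map \<zeta>)\<^sup>2) / 2) (at \<zeta>)"
  unfolding one_minus_strip_map_sq[OF assms] unfolding strip_map_def[abs_def]
  using strip_exp_plus_1_nonzero[OF assms]
  by (auto intro!: derivative_eq_intros simp: divide_simps power2_eq_square) (simp add: algebra_simps)

lemma strip_map_holomorphic: "strip_map holomorphic_on strip"
  using has_field_derivative_strip_map open_strip by (auto simp: holomorphic_on_open)

text \<open>
  This identity is the reason for the strip: the quotient of \<open>1 - (norm z)\<^sup>2\<close> by
  \<open>norm (1 - z\<^sup>2)\<close> depends on the imaginary part of \<open>\<zeta>\<close> only.
\<close>

lemma one_minus_norm_strip_map_sq:
  assumes "\<zeta> \<in> strip"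
  shows "1 - (norm (strip_map \<zeta>))\<^sup>2 = cos (Im \<zeta>) * norm (1 - (strip_map \<zeta>)\<^sup>2)"
proof -
  let ?u = "exp \<zeta>"
  have ne: "norm (?u + 1) \<noteq> 0" using strip_exp_plus_1_nonzero[OF assms] by simp
  have "1 - (norm (strip_map \<zeta>))\<^sup>2 = ((norm (?u + 1))\<^sup>2 - (norm (?u - 1))\<^sup>2) / (norm (?u + 1))\<^sup>2"
  proof -
    have "(norm (strip_map \<zeta>))\<^sup>2 = (norm (?u - 1))\<^sup>2 / (norm (?u + 1))\<^sup>2"
      by (simp add: strip_map_def norm_divide power_divide)
    then show ?thesis using ne by (simp add: diff_divide_distrib)
  qed
  also have "(norm (?u + 1))\<^sup>2 - (norm (?u - 1))\<^sup>2 = 4 * Re ?u"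
    by (simp add: cmod_power2) (simp add: power2_eq_square algebra_simps)
  finally show ?thesis unfolding norm_one_minus_strip_map_sq[OF assms] by (simp add: Re_exp)
qed

lemma strip_map_image: "strip_map ` strip = unit_disk"
proof (intro equalityI subsetI)
  fix z assume "z \<in> strip_map ` strip"
  then obtain \<zeta> where \<zeta>: "\<zeta> \<in> strip" "z = strip_map \<zeta>" by auto
  have "norm (1 - (strip_map \<zeta>)\<^sup>2) > 0"
    using strip_exp_plus_1_nonzero[OF \<zeta>(1)] unfolding norm_one_minus_strip_map_sq[OF \<zeta>(1)] by simp
  then have "1 - (norm z)\<^sup>2 > 0"
    unfolding \<zeta>(2) one_minus_norm_strip_map_sq[OF \<zeta>(1)] using strip_cos_pos[OF \<zeta>(1)] by simp
  then show "z \<in> unit_disk" by (simp add: power_less_one_iff abs_square_less_1)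
next
  fix z :: complex assume "z \<in> unit_disk"
  then have z: "norm z < 1" by simp
  then have ne: "1 - z \<noteq> 0" by auto
  \<comment> \<open>\<open>u\<close> is the value of \<open>exp \<zeta>\<close> at the preimage \<open>\<zeta>\<close> of \<open>z\<close>.\<close>
  define u where "u = (1 + z) / (1 - z)"
  have "Re ((1 + z) * cnj (1 - z)) = 1 - (norm z)\<^sup>2"
    unfolding cmod_power2 by (simp add: power2_eq_square algebra_simps)
  then have "Re u = (1 - (norm z)\<^sup>2) / (norm (1 - z))\<^sup>2"
    unfolding u_def by (simp add: complex_div_cnj[of "1 + z"])
  then have pos: "Re u > 0"
    using z ne by (simp add: power_less_one_iff abs_square_less_1)
  then have "u \<noteq> 0" by auto
  have "Ln u \<in> strip" unfolding strip_def using Re_Ln_pos_lt_imp[OF pos] \<open>u \<noteq> 0\<close> by simp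
  moreover have "strip_map (Ln u) = z"
    using ne \<open>u \<noteq> 0\<close> unfolding strip_map_def by (simp add: u_def divide_simps)
  ultimately show "z \<in> strip_map ` strip" by (metis imageI)
qed

lemma strip_map_in_disk: "\<zeta> \<in> strip \<Longrightarrow> strip_map \<zeta> \<in> unit_disk"
  using strip_map_image by blast

lemma inj_on_strip_map: "inj_on strip_map strip"
proof (rule inj_onI)
  fix x y assume x: "x \<in> strip" and y: "y \<in> strip" and eq: "strip_map x = strip_map y"
  have "exp x = exp y"
    using eq strip_exp_plus_1_nonzero[OF x] strip_exp_plus_1_nonzero[OF y]
    by (simp add: strip_map_def divide_simps) (simp add: algebra_simps)
  moreover have "\<bar>Im x - Im y\<bar> < 2 * pi" using x y unfolding strip_def by auto
  ultimately show "x = y" using exp_complex_eqI by blast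
qed

text \<open>
  Here \<open>1 - z\<^sup>2 = 4 u / (u + 1)\<^sup>2\<close> with \<open>u = exp \<zeta>\<close>. As \<open>u\<close> has positive real part, the square
  of \<open>norm (u + 1)\<close> lies between \<open>1 + (norm u)\<^sup>2\<close> and \<open>(1 + norm u)\<^sup>2\<close>.
\<close>

lemma norm_one_minus_strip_map_sq_bounds:
  assumes "\<zeta> \<in> strip"
  shows "norm (1 - (strip_map \<zeta>)\<^sup>2) \<le> 4 * exp (- \<bar>Re \<zeta>\<bar>)"
    and "exp (- \<bar>Re \<zeta>\<bar>) \<le> norm (1 - (strip_map \<zeta>)\<^sup>2)"
proof -
  let ?u = "exp \<zeta>" and ?e = "exp (Re \<zeta>)"
  have "(norm (?u + 1))\<^sup>2 = 1 + 2 * Re ?u + ((Re ?u)\<^sup>2 + (Im ?u)\<^sup>2)"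
    by (simp add: cmod_power2) (simp add: power2_eq_square algebra_simps)
  also have "(Re ?u)\<^sup>2 + (Im ?u)\<^sup>2 = ?e\<^sup>2"
    by (simp add: norm_exp_eq_Re flip: cmod_power2)
  finally have n: "(norm (?u + 1))\<^sup>2 = 1 + 2 * Re ?u + ?e\<^sup>2" .
  have re: "0 < Re ?u" "Re ?u \<le> ?e"
    using strip_Re_exp_pos[OF assms] complex_Re_le_cmod[of ?u] by (auto simp: norm_exp_eq_Re)
  have e: "?e > 0" by simp
  have pos: "0 < 1 + 2 * Re ?u + ?e\<^sup>2" using re by (simp add: add_pos_pos)
  have inv: "?e * exp (- Re \<zeta>) = 1" by (simp add: exp_minus)
  show "norm (1 - (strip_map \<zeta>)\<^sup>2) \<le> 4 * exp (- \<bar>Re \<zeta>\<bar>)"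
  proof (cases "Re \<zeta> \<ge> 0")
    case True
    have "?e * 1 \<le> exp (- Re \<zeta>) * (1 + 2 * Re ?u + ?e\<^sup>2)"
      using re by (simp add: distrib_left exp_minus power2_eq_square field_simps)
    then show ?thesis unfolding norm_one_minus_strip_map_sq[OF assms] n
      using True pos by (simp add: divide_le_eq)
  next
    case False
    have "?e * 1 \<le> ?e * (1 + 2 * Re ?u + ?e\<^sup>2)"
      using re by (intro mult_left_mono) auto
    then show ?thesis unfolding norm_one_minus_strip_map_sq[OF assms] n
      using False pos by (simp add: divide_le_eq)
  qed
  show "exp (- \<bar>Re \<zeta>\<bar>) \<le> norm (1 - (strip_map \<zeta>)\<^sup>2)"
  proof (cases "Re \<zeta> \<ge> 0")
    case True
    then have e1: "?e \<ge> 1" by simp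
    have "1 + 2 * Re ?u + ?e\<^sup>2 \<le> ?e * ?e + 2 * (?e * ?e) + ?e * ?e"
    proof -
      have "?e \<le> ?e * ?e" using mult_left_mono[OF e1 less_imp_le[OF e]] by simp
      then show ?thesis unfolding power2_eq_square using e1 re by linarith
    qed
    then have "exp (- Re \<zeta>) * (1 + 2 * Re ?u + ?e\<^sup>2) \<le> exp (- Re \<zeta>) * (4 * (?e * ?e))"
      by (intro mult_left_mono) auto
    also have "\<dots> = 4 * ?e" using inv by (simp add: mult.commute)
    finally show ?thesis unfolding norm_one_minus_strip_map_sq[OF assms] n
      using True pos by (simp add: le_divide_eq)
  next
    case False
    then have e1: "?e \<le> 1" by simp
    have "1 + 2 * Re ?u + ?e\<^sup>2 \<le> 4"
    proof -
      have "?e * ?e \<le> 1" using e1 by (intro mult_le_one) auto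
      then show ?thesis unfolding power2_eq_square using e1 re by linarith
    qed
    then have "?e * (1 + 2 * Re ?u + ?e\<^sup>2) \<le> ?e * 4"
      by (intro mult_left_mono) auto
    then show ?thesis unfolding norm_one_minus_strip_map_sq[OF assms] n
      using False pos by (simp add: le_divide_eq)
  qed
qed

text \<open>
  The function \<open>h\<close> stands for \<open>(norm (\<phi> z))\<^sup>2\<close>. Of the exponent \<open>a + 2\<close>, the part \<open>a\<close> comes from
  the weight and \<open>2\<close> from the Jacobian.
\<close>

lemma weighted_disk_integral_strip:
  fixes h :: "complex \<Rightarrow> real"
  assumes h: "continuous_on unit_disk h"
  shows "set_integrable lborel unit_disk (\<lambda>z. h z * (1 - (norm z)\<^sup>2) powr a) \<longleftrightarrow>
      set_integrable lborel strip (\<lambda>\<zeta>. h (strip_map \<zeta>) * norm (1 - (strip_map \<zeta>)\<^sup>2) powr (a + 2) * cos (Im \<zeta>) powr a)"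
    (is "?A \<longleftrightarrow> ?B")
    and "set_integrable lborel unit_disk (\<lambda>z. h z * (1 - (norm z)\<^sup>2) powr a) \<Longrightarrow>
      (LINT z:unit_disk|lborel. h z * (1 - (norm z)\<^sup>2) powr a) =
      (LINT \<zeta>:strip|lborel. h (strip_map \<zeta>) * norm (1 - (strip_map \<zeta>)\<^sup>2) powr (a + 2) * cos (Im \<zeta>) powr a) / 4"
proof -
  let ?f = "\<lambda>z. h z * (1 - (norm z)\<^sup>2) powr a"
  let ?g = "\<lambda>\<zeta>. h (strip_map \<zeta>) * norm (1 - (strip_map \<zeta>)\<^sup>2) powr (a + 2) * cos (Im \<zeta>) powr a"
  have "1 - (norm z)\<^sup>2 \<noteq> 0" if "norm z < 1" for z :: complex
    using that by (simp add: abs_square_eq_1 power2_eq_1_iff) 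
  then have "continuous_on unit_disk ?f"
    using h by (intro continuous_intros) auto
  then have f: "continuous_on (strip_map ` strip) ?f" unfolding strip_map_image .
  have eq: "(norm (deriv strip_map \<zeta>))\<^sup>2 * ?f (strip_map \<zeta>) = ?g \<zeta> / 4" if \<zeta>: "\<zeta> \<in> strip" for \<zeta>
  proof -
    let ?n = "norm (1 - (strip_map \<zeta>)\<^sup>2)"
    have n: "?n > 0"
      using strip_exp_plus_1_nonzero[OF \<zeta>] unfolding norm_one_minus_strip_map_sq[OF \<zeta>] by simp
    have "(norm (deriv strip_map \<zeta>))\<^sup>2 = ?n\<^sup>2 / 4"
      unfolding DERIV_imp_deriv[OF has_field_derivative_strip_map[OF \<zeta>]] by (simp add: norm_divide power_divide)
    moreover have "(1 - (norm (strip_map \<zeta>))\<^sup>2) powr a = cos (Im \<zeta>) powr a * ?n powr a"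
      unfolding one_minus_norm_strip_map_sq[OF \<zeta>] using strip_cos_pos[OF \<zeta>] n by (simp add: powr_mult)
    moreover have "?n powr (a + 2) = ?n powr a * ?n\<^sup>2"
      using n by (simp add: powr_add powr_numeral)
    ultimately show ?thesis by simp
  qed
  have eq': "set_integrable lborel strip (\<lambda>\<zeta>. (norm (deriv strip_map \<zeta>))\<^sup>2 * ?f (strip_map \<zeta>)) \<longleftrightarrow>
     set_integrable lborel strip (\<lambda>\<zeta>. ?g \<zeta> / 4)"
    by (rule set_integrable_cong) (use eq in auto)
  note cv = holomorphic_change_of_variables[OF open_strip strip_map_holomorphic inj_on_strip_map f, unfolded strip_map_image]
  show "?A \<longleftrightarrow> ?B" unfolding cv(1) eq' by simp
  assume ?A
  have "(LINT z:unit_disk|lborel. ?f z) = (LINT \<zeta>:strip|lborel. ?g \<zeta> / 4)"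
    unfolding cv(2)[OF \<open>?A\<close>] by (rule set_lebesgue_integral_cong) (use eq open_strip in auto)
  then show "(LINT z:unit_disk|lborel. ?f z) = (LINT \<zeta>:strip|lborel. ?g \<zeta>) / 4" by simp
qed

section \<open>Green's identity on a rectangle\<close>

lemma integral_by_parts_twice:
  fixes f w :: "real \<Rightarrow> real"
  assumes "a \<le> b"
    and f: "\<And>x. x \<in> {a..b} \<Longrightarrow> (f has_vector_derivative f' x) (at x)"
      "\<And>x. x \<in> {a..b} \<Longrightarrow> (f' has_vector_derivative f'' x) (at x)" "continuous_on {a..b} f''"
    and w: "\<And>x. x \<in> {a..b} \<Longrightarrow> (w has_vector_derivative w' x) (at x)"
      "\<And>x. x \<in> {a..b} \<Longrightarrow> (w' has_vector_derivative w'' x) (at x)" "continuous_on {a..b} w''"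
    and ends: "w a = 0" "w b = 0" "w' a = 0" "w' b = 0"
  shows "integral {a..b} (\<lambda>x. f x * w'' x) = integral {a..b} (\<lambda>x. f'' x * w x)"
proof -
  have cont: "continuous_on {a..b} f" "continuous_on {a..b} w"
    using f(1) w(1) by (meson has_vector_derivative_continuous continuous_at_imp_continuous_on)+
  have "((\<lambda>x. f x * w'' x - f'' x * w x) has_integral (f b * w' b - f' b * w b - (f a * w' a - f' a * w a))) {a..b}"
  proof (rule fundamental_theorem_of_calculus[OF \<open>a \<le> b\<close>])
    fix x assume x: "x \<in> {a..b}"
    note d = f(1,2)[OF x] w(1,2)[OF x]
    have "((\<lambda>x. f x * w' x - f' x * w x) has_vector_derivative
        (f x * w'' x + f' x * w' x) - (f' x * w' x + f'' x * w x)) (at x)"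
      by (rule has_vector_derivative_diff[OF has_vector_derivative_mult[OF d(1,4)] has_vector_derivative_mult[OF d(2,3)]])
    then show "((\<lambda>x. f x * w' x - f' x * w x) has_vector_derivative f x * w'' x - f'' x * w x) (at x within {a..b})"
      using has_vector_derivative_at_within by fastforce
  qed
  then have "integral {a..b} (\<lambda>x. f x * w'' x - f'' x * w x) = 0"
    using ends by (simp add: integral_unique)
  moreover have "(\<lambda>x. f x * w'' x) integrable_on {a..b}" "(\<lambda>x. f'' x * w x) integrable_on {a..b}"
    by (intro integrable_continuous_interval continuous_intros cont f w)+
  ultimately show ?thesis by (simp add: integral_diff)
qed

text \<open>
  The Laplacian of \<open>(norm \<psi>)\<^sup>2\<close> is \<open>4 (norm \<psi>')\<^sup>2\<close>. The test function \<open>u(s) w(t)\<close> vanishes to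
  first order on the boundary of the rectangle, so integrating by parts twice in each variable
  produces no boundary terms. In the proof \<open>E\<close> is \<open>2 (norm \<psi>')\<^sup>2\<close> and \<open>R\<close> is
  \<open>2 Re (\<psi>'' * cnj \<psi>)\<close>; the second derivatives of \<open>(norm \<psi>)\<^sup>2\<close> in the two variables are
  \<open>E + R\<close> and \<open>E - R\<close>, and \<open>R\<close> cancels in their sum.
\<close>

lemma integral_norm_sq_laplacian_nonneg:
  fixes \<psi> :: "complex \<Rightarrow> complex" and u w :: "real \<Rightarrow> real"
  assumes hol: "\<psi> holomorphic_on U" and "open U" and sub: "cbox (Complex a c) (Complex b d) \<subseteq> U"
    and "a \<le> b" "c \<le> d"
    and u: "\<And>x. (u has_vector_derivative u' x) (at x)" "\<And>x. (u' has_vector_derivative u'' x) (at x)"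
      "continuous_on {a..b} u''" "\<And>x. x \<in> {a..b} \<Longrightarrow> u x \<ge> 0" "u a = 0" "u b = 0" "u' a = 0" "u' b = 0"
    and w: "\<And>x. x \<in> {c..d} \<Longrightarrow> (w has_vector_derivative w' x) (at x)"
      "\<And>x. x \<in> {c..d} \<Longrightarrow> (w' has_vector_derivative w'' x) (at x)"
      "continuous_on {c..d} w''" "\<And>x. x \<in> {c..d} \<Longrightarrow> w x \<ge> 0" "w c = 0" "w d = 0" "w' c = 0" "w' d = 0"
  shows "(LINT \<zeta>:cbox (Complex a c) (Complex b d)|lborel. (norm (\<psi> \<zeta>))\<^sup>2 *
     (u (Re \<zeta>) * w'' (Im \<zeta>) + u'' (Re \<zeta>) * w (Im \<zeta>))) \<ge> 0"
proof -
  define D1 where "D1 = deriv \<psi>"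
  define D2 where "D2 = deriv D1"
  have hol1: "D1 holomorphic_on U" and hol2: "D2 holomorphic_on U"
    unfolding D1_def D2_def using hol \<open>open U\<close> by (auto intro!: holomorphic_deriv)
  have inU: "Complex s t \<in> U" if "s \<in> {a..b}" "t \<in> {c..d}" for s t
    using that sub by (auto simp: cbox_Complex_eq box_def cbox_def Basis_complex_def subset_iff)
  have d1: "(\<psi> has_field_derivative D1 z) (at z)" and d2: "(D1 has_field_derivative D2 z) (at z)" if "z \<in> U" for z
    unfolding D1_def D2_def using that hol hol1 \<open>open U\<close> by (auto intro!: holomorphic_derivI simp: D1_def)
  have horiz: "((\<lambda>s. f (Complex s t)) has_vector_derivative f') (at s)"
    and vert: "((\<lambda>t. f (Complex s t)) has_vector_derivative \<i> * f') (at t)"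
    if "(f has_field_derivative f') (at (Complex s t))" for f :: "complex \<Rightarrow> complex" and f' s t
  proof -
    have "((\<lambda>s. Complex s t) has_vector_derivative 1) (at s)"
      unfolding Complex_eq by (auto intro!: derivative_eq_intros)
    from field_vector_diff_chain_at[OF this, of f f'] that
    show "((\<lambda>s. f (Complex s t)) has_vector_derivative f') (at s)" by (simp add: o_def)
    have "((\<lambda>t. Complex s t) has_vector_derivative \<i>) (at t)"
      unfolding Complex_eq by (auto intro!: derivative_eq_intros)
    from field_vector_diff_chain_at[OF this, of f f'] that
    show "((\<lambda>t. f (Complex s t)) has_vector_derivative \<i> * f') (at t)" by (simp add: o_def)
  qed
  define v where "v s t = (norm (\<psi> (Complex s t)))\<^sup>2" for s t
  define vs where "vs s t = 2 * (\<psi> (Complex s t) \<bullet> D1 (Complex s t))" for s t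
  define vt where "vt s t = 2 * (\<psi> (Complex s t) \<bullet> (\<i> * D1 (Complex s t)))" for s t
  define E where "E s t = 2 * (norm (D1 (Complex s t)))\<^sup>2" for s t
  define R where "R s t = 2 * (\<psi> (Complex s t) \<bullet> D2 (Complex s t))" for s t
  have v_inner: "v = (\<lambda>s t. \<psi> (Complex s t) \<bullet> \<psi> (Complex s t))"
    unfolding v_def power2_norm_eq_inner ..
  note ip = bounded_bilinear.has_vector_derivative[OF bounded_bilinear_inner]
  have ds: "((\<lambda>s. v s t) has_vector_derivative vs s t) (at s)"
    "((\<lambda>s. vs s t) has_vector_derivative E s t + R s t) (at s)"
    and dt: "((\<lambda>t. v s t) has_vector_derivative vt s t) (at t)"
    "((\<lambda>t. vt s t) has_vector_derivative E s t - R s t) (at t)"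
    if "s \<in> {a..b}" "t \<in> {c..d}" for s t
  proof -
    note z = inU[OF that]
    note h = horiz[OF d1[OF z]] horiz[OF d2[OF z]] vert[OF d1[OF z]] vert[OF d2[OF z]]
    show "((\<lambda>s. v s t) has_vector_derivative vs s t) (at s)"
      using ip[OF h(1) h(1)] unfolding v_inner vs_def by (simp add: inner_commute)
    show "((\<lambda>t. v s t) has_vector_derivative vt s t) (at t)"
      using ip[OF h(3) h(3)] unfolding v_inner vt_def by (simp add: inner_commute)
    show "((\<lambda>s. vs s t) has_vector_derivative E s t + R s t) (at s)"
      using has_vector_derivative_mult_right[OF ip[OF h(1) h(2)], of 2] unfolding vs_def E_def R_def power2_norm_eq_inner
      by (simp add: algebra_simps)
    have "((\<lambda>t. \<i> * D1 (Complex s t)) has_vector_derivative \<i> * (\<i> * D2 (Complex s t))) (at t)"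
      by (rule has_vector_derivative_mult_right[OF h(4)])
    from has_vector_derivative_mult_right[OF ip[OF h(3) this], of 2]
    show "((\<lambda>t. vt s t) has_vector_derivative E s t - R s t) (at t)"
      unfolding vt_def E_def R_def power2_norm_eq_inner
      by (simp add: algebra_simps inner_complex_def)
  qed
  let ?B = "cbox (a, c) (b, d)"
  have contC: "continuous_on ?B (\<lambda>p. f (Complex (fst p) (snd p)))" if "f holomorphic_on U" for f
    by (rule continuous_on_compose2[OF holomorphic_on_imp_continuous_on[OF that]])
       (auto intro!: continuous_intros inU simp: cbox_Pair_eq)
  note cC = contC[OF hol] contC[OF hol1] contC[OF hol2]
  have v_cont: "continuous_on ?B (\<lambda>p. v (fst p) (snd p))" and E_cont: "continuous_on ?B (\<lambda>p. E (fst p) (snd p))"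
    and R_cont: "continuous_on ?B (\<lambda>p. R (fst p) (snd p))"
    unfolding v_def E_def R_def by (intro continuous_intros cC)+
  have u_cont: "continuous_on {a..b} u" and w_cont: "continuous_on {c..d} w"
    using u(1) w(1) by (meson has_vector_derivative_continuous continuous_at_imp_continuous_on)+
  have c1: "continuous_on ?B (\<lambda>p. f (fst p))" if "continuous_on {a..b} f" for f :: "real \<Rightarrow> real"
    by (rule continuous_on_compose2[OF that]) (auto intro!: continuous_intros simp: cbox_Pair_eq)
  have c2: "continuous_on ?B (\<lambda>p. f (snd p))" if "continuous_on {c..d} f" for f :: "real \<Rightarrow> real"
    by (rule continuous_on_compose2[OF that]) (auto intro!: continuous_intros simp: cbox_Pair_eq)
  note conts = v_cont E_cont R_cont c1[OF u_cont] c1[OF u(3)] c2[OF w_cont] c2[OF w(3)]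
  have line_s: "continuous_on {a..b} (\<lambda>s. f s t)" if "continuous_on ?B (\<lambda>p. f (fst p) (snd p))" "t \<in> {c..d}"
    for f :: "real \<Rightarrow> real \<Rightarrow> real" and t
    by (rule continuous_on_compose2[OF that(1), of _ "\<lambda>s. (s, t)", simplified]) (use that in \<open>auto intro!: continuous_intros simp: cbox_Pair_eq\<close>)
  have line_t: "continuous_on {c..d} (\<lambda>t. f s t)" if "continuous_on ?B (\<lambda>p. f (fst p) (snd p))" "s \<in> {a..b}"
    for f :: "real \<Rightarrow> real \<Rightarrow> real" and s
    by (rule continuous_on_compose2[OF that(1), of _ "\<lambda>t. (s, t)", simplified]) (use that in \<open>auto intro!: continuous_intros simp: cbox_Pair_eq\<close>)
  have parts_t: "integral {c..d} (\<lambda>t. v s t * w'' t) = integral {c..d} (\<lambda>t. (E s t - R s t) * w t)"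
    if s: "s \<in> {a..b}" for s
  proof (rule integral_by_parts_twice[OF \<open>c \<le> d\<close> dt(1)[OF s] dt(2)[OF s] _ w(1,2,3,5-8)])
    show "continuous_on {c..d} (\<lambda>t. E s t - R s t)"
      by (rule continuous_on_diff[OF line_t[OF E_cont s] line_t[OF R_cont s]])
  qed auto
  have parts_s: "integral {a..b} (\<lambda>s. v s t * u'' s) = integral {a..b} (\<lambda>s. (E s t + R s t) * u s)"
    if t: "t \<in> {c..d}" for t
  proof (rule integral_by_parts_twice[OF \<open>a \<le> b\<close> ds(1)[OF _ t] ds(2)[OF _ t] _ u(1,2,3,5-8)])
    show "continuous_on {a..b} (\<lambda>s. E s t + R s t)"
      by (rule continuous_on_add[OF line_s[OF E_cont t] line_s[OF R_cont t]])
  qed auto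
  let ?I = "\<lambda>f. integral ?B (\<lambda>p. f (fst p) (snd p))"
  have st: "?I f = integral {a..b} (\<lambda>s. integral {c..d} (\<lambda>t. f s t))"
    and ts: "?I f = integral {c..d} (\<lambda>t. integral {a..b} (\<lambda>s. f s t))"
    if "continuous_on ?B (\<lambda>p. f (fst p) (snd p))" for f :: "real \<Rightarrow> real \<Rightarrow> real"
  proof -
    show 1: "?I f = integral {a..b} (\<lambda>s. integral {c..d} (\<lambda>t. f s t))"
      using integral_prod_continuous[OF that] by simp
    show "?I f = integral {c..d} (\<lambda>t. integral {a..b} (\<lambda>s. f s t))"
      unfolding 1 using integral_swap_continuous[of a c b d f] that by (simp add: split_beta)
  qed
  have "?I (\<lambda>s t. u s * (v s t * w'' t)) = integral {a..b} (\<lambda>s. integral {c..d} (\<lambda>t. u s * (v s t * w'' t)))"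
    by (intro st continuous_intros conts)
  also have "\<dots> = integral {a..b} (\<lambda>s. integral {c..d} (\<lambda>t. u s * ((E s t - R s t) * w t)))"
    by (rule Henstock_Kurzweil_Integration.integral_cong) (simp add: parts_t)
  also have "\<dots> = ?I (\<lambda>s t. u s * ((E s t - R s t) * w t))"
    by (intro st[symmetric] continuous_intros conts)
  finally have 1: "?I (\<lambda>s t. u s * (v s t * w'' t)) = ?I (\<lambda>s t. u s * ((E s t - R s t) * w t))" .
  have "?I (\<lambda>s t. w t * (v s t * u'' s)) = integral {c..d} (\<lambda>t. integral {a..b} (\<lambda>s. w t * (v s t * u'' s)))"
    by (intro ts continuous_intros conts)
  also have "\<dots> = integral {c..d} (\<lambda>t. integral {a..b} (\<lambda>s. w t * ((E s t + R s t) * u s)))"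
    by (rule Henstock_Kurzweil_Integration.integral_cong) (simp add: parts_s)
  also have "\<dots> = ?I (\<lambda>s t. w t * ((E s t + R s t) * u s))"
    by (intro ts[symmetric] continuous_intros conts)
  finally have 2: "?I (\<lambda>s t. w t * (v s t * u'' s)) = ?I (\<lambda>s t. w t * ((E s t + R s t) * u s))" .
  have int: "f integrable_on ?B" if "continuous_on ?B f" for f :: "real \<times> real \<Rightarrow> real"
    by (rule integrable_continuous[OF that])
  have "?I (\<lambda>s t. v s t * (u s * w'' t + u'' s * w t)) =
      ?I (\<lambda>s t. u s * (v s t * w'' t) + w t * (v s t * u'' s))"
    by (simp add: algebra_simps)
  also have "\<dots> = ?I (\<lambda>s t. u s * (v s t * w'' t)) + ?I (\<lambda>s t. w t * (v s t * u'' s))"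
    by (intro Henstock_Kurzweil_Integration.integral_add int continuous_intros conts)
  also have "\<dots> = ?I (\<lambda>s t. u s * ((E s t - R s t) * w t)) + ?I (\<lambda>s t. w t * ((E s t + R s t) * u s))"
    unfolding 1 2 ..
  also have "\<dots> = ?I (\<lambda>s t. u s * ((E s t - R s t) * w t) + w t * ((E s t + R s t) * u s))"
    by (intro Henstock_Kurzweil_Integration.integral_add[symmetric] int continuous_intros conts)
  also have "\<dots> = ?I (\<lambda>s t. 2 * u s * w t * E s t)"
    by (simp add: algebra_simps)
  also have "\<dots> \<ge> 0"
  proof (rule Henstock_Kurzweil_Integration.integral_nonneg)
    show "(\<lambda>p. 2 * u (fst p) * w (snd p) * E (fst p) (snd p)) integrable_on ?B"
      by (intro int continuous_intros conts)
  qed (auto simp: cbox_Pair_eq E_def u(4) w(4))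
  finally have nonneg: "?I (\<lambda>s t. v s t * (u s * w'' t + u'' s * w t)) \<ge> 0" .
  let ?F = "\<lambda>s t. v s t * (u s * w'' t + u'' s * w t)"
  let ?K = "cbox (Complex a c) (Complex b d)"
  have meas: "(\<lambda>(x, y). Complex x y) \<in> borel \<rightarrow>\<^sub>M borel"
    by (intro borel_measurable_continuous_onI) (auto simp: split_beta intro!: continuous_intros)
  have cF: "continuous_on ?B (\<lambda>p. ?F (fst p) (snd p))" by (intro continuous_intros conts)
  have K: "continuous_on ?K (\<lambda>\<zeta>. ?F (Re \<zeta>) (Im \<zeta>))"
    by (rule continuous_on_compose2[OF cF, of _ "\<lambda>\<zeta>. (Re \<zeta>, Im \<zeta>)", simplified])
       (auto intro!: continuous_intros simp: cbox_Pair_eq cbox_Complex_eq)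
  have "(LINT \<zeta>:?K|lborel. ?F (Re \<zeta>) (Im \<zeta>)) = (LINT p|(lborel \<Otimes>\<^sub>M lborel). indicator ?K (Complex (fst p) (snd p)) *\<^sub>R ?F (fst p) (snd p))"
    unfolding set_lebesgue_integral_def lborel_complex_eq_prod
    by (subst integral_distr) (use meas borel_measurable_continuous_on_indicator[OF _ K] in \<open>auto simp: lborel_prod split_beta\<close>)
  also have "\<dots> = (LINT p:?B|lborel. ?F (fst p) (snd p))"
    unfolding set_lebesgue_integral_def lborel_prod
    by (rule Bochner_Integration.integral_cong) (auto simp: indicator_def cbox_Pair_eq cbox_Complex_eq)
  also have "\<dots> = ?I ?F"
    by (rule set_borel_integral_eq_integral) (rule borel_integrable_compact[unfolded set_integrable_def[symmetric]], use cF in auto)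
  finally show ?thesis using nonneg by (simp add: v_def)
qed

section \<open>The sharp weight comparison in the strip\<close>

text \<open>
  The power function with exponent \<open>m > 1\<close> is convex, so it stays above its tangent at \<open>d\<close>.
\<close>

lemma powr_above_tangent:
  fixes x d m :: real
  assumes "x > 0" "d > 0" "m > 1"
  shows "0 \<le> x powr m - m * d powr (m - 1) * x + (m - 1) * d powr m"
proof -
  have "x * d powr (m - 1) \<le> x powr m / m + (d powr (m - 1)) powr (m / (m - 1)) / (m / (m - 1))"
    using assms by (intro Youngs_inequality) (auto simp: field_simps)
  also have "(d powr (m - 1)) powr (m / (m - 1)) = d powr m"
    using assms by (simp add: powr_powr)
  finally have "m * (x * d powr (m - 1)) \<le> m * (x powr m / m + d powr m / (m / (m - 1)))"
    using assms by (intro mult_left_mono) auto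
  also have "\<dots> = x powr m + (m - 1) * d powr m"
    using assms by (simp add: field_simps)
  finally show ?thesis by (simp add: algebra_simps)
qed

text \<open>
  The ideal test function \<open>cos t powr (a + 2)\<close> has to be cut off so that it lives on a compact
  part of the strip, where \<open>\<psi>\<close> is smooth. In the direction of the strip the factor \<open>u\<close> does this at
  the cost of a second derivative of size \<open>1 / T\<^sup>2\<close>. Across the strip one subtracts from
  \<open>x powr (a + 2)\<close>, with \<open>x = cos t\<close>, its tangent at \<open>x = d\<close>. The remainder \<open>w\<close> is nonnegative
  by convexity and vanishes to first order where \<open>cos t = d\<close>; its second derivative differs from
  the ideal one by \<open>(a + 2) * d powr (a + 1) * cos t\<close>, which vanishes in the limit \<open>d = 0\<close>. Since
  \<open>d \<le> cos t\<close> on the support, everything is bounded by a multiple of \<open>cos t powr a\<close>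
  independent of \<open>d\<close> and \<open>T\<close>. This makes dominated convergence available for every exponent
  \<open>a > -1\<close>, including the negative ones, for which \<open>cos t powr a\<close> is unbounded.
\<close>

lemma strip_cutoff_laplacian:
  fixes \<psi> :: "complex \<Rightarrow> complex" and a d T :: real
  defines "b \<equiv> arccos d"
  defines "K \<equiv> cbox (Complex (- T) (- b)) (Complex T b)"
  defines "u \<equiv> (\<lambda>s. (cos (pi * s / (2 * T)))\<^sup>2)"
  defines "u'' \<equiv> (\<lambda>s. - (pi\<^sup>2 / (2 * T\<^sup>2)) * cos (pi * s / T))"
  defines "w \<equiv> (\<lambda>t. cos t powr (a + 2) - (a + 2) * d powr (a + 1) * cos t + (a + 1) * d powr (a + 2))"
  defines "w'' \<equiv> (\<lambda>t. (a + 2) * ((a + 1) * cos t powr a - (a + 2) * cos t powr (a + 2)) + (a + 2) * d powr (a + 1) * cos t)"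
  assumes a: "a > -1" and d: "0 < d" "d < 1" and T: "T > 0" and hol: "\<psi> holomorphic_on strip"
  shows "K \<subseteq> strip"
    and "\<zeta> \<in> strip \<Longrightarrow> \<bar>Re \<zeta>\<bar> \<le> T \<Longrightarrow> d \<le> cos (Im \<zeta>) \<Longrightarrow> \<zeta> \<in> K"
    and "(LINT \<zeta>:K|lborel. (norm (\<psi> \<zeta>))\<^sup>2 * (u (Re \<zeta>) * w'' (Im \<zeta>) + u'' (Re \<zeta>) * w (Im \<zeta>))) \<ge> 0"
    and "\<zeta> \<in> K \<Longrightarrow> T \<ge> 1 \<Longrightarrow> \<bar>u (Re \<zeta>) * w'' (Im \<zeta>) + u'' (Re \<zeta>) * w (Im \<zeta>)\<bar> \<le>
       ((a + 2) * (2 * a + 4) + pi\<^sup>2 * (a + 2)) * cos (Im \<zeta>) powr a"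
proof -
  have b: "0 < b" "b < pi / 2" "cos b = d"
    unfolding b_def using d arccos_lt_bounded[of d] arccos_less_arccos[of 0 d] by (auto simp: cos_arccos)
  have cos_ge: "d \<le> cos t" if "t \<in> {-b..b}" for t
  proof -
    have "cos b \<le> cos \<bar>t\<bar>" using that b by (intro cos_monotone_0_pi_le) auto
    then show ?thesis using b by simp
  qed
  show sub: "K \<subseteq> strip"
    unfolding K_def strip_def using b by (auto simp: cbox_Complex_eq)
  show "\<zeta> \<in> K" if \<zeta>: "\<zeta> \<in> strip" "\<bar>Re \<zeta>\<bar> \<le> T" "d \<le> cos (Im \<zeta>)"
  proof -
    have "arccos (cos \<bar>Im \<zeta>\<bar>) \<le> arccos d"
      using \<zeta> d by (intro arccos_le_arccos) auto
    also have "arccos (cos \<bar>Im \<zeta>\<bar>) = \<bar>Im \<zeta>\<bar>"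
      using \<zeta>(1) unfolding strip_def by (intro arccos_cos) auto
    finally show ?thesis unfolding K_def b_def[symmetric] using \<zeta>(2) by (auto simp: in_cbox_complex_iff abs_le_iff)
  qed
  define u' where "u' s = - (pi / (2 * T)) * sin (pi * s / T)" for s
  define w' where "w' t = - (a + 2) * cos t powr (a + 1) * sin t + (a + 2) * d powr (a + 1) * sin t" for t
  have w_nonneg: "w t \<ge> 0" if "t \<in> {-b..b}" for t
    unfolding w_def using powr_above_tangent[of "cos t" d "a + 2"] cos_ge[OF that] d a by (simp add: algebra_simps)
  show "(LINT \<zeta>:K|lborel. (norm (\<psi> \<zeta>))\<^sup>2 * (u (Re \<zeta>) * w'' (Im \<zeta>) + u'' (Re \<zeta>) * w (Im \<zeta>))) \<ge> 0"
    unfolding K_def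
  proof (rule integral_norm_sq_laplacian_nonneg[OF hol open_strip, where u' = u' and w' = w'])
    show "cbox (Complex (- T) (- b)) (Complex T b) \<subseteq> strip" using sub unfolding K_def .
    show "- T \<le> T" "- b \<le> b" using T b by auto
    fix x
    have "(u has_real_derivative 2 * cos (pi * x / (2 * T)) * (- sin (pi * x / (2 * T)) * (pi / (2 * T)))) (at x)"
      unfolding u_def using T by (auto intro!: derivative_eq_intros)
    also have "2 * cos (pi * x / (2 * T)) * (- sin (pi * x / (2 * T)) * (pi / (2 * T))) = u' x"
      using sin_double[of "pi * x / (2 * T)"] T unfolding u'_def by (simp add: field_simps)
    finally show "(u has_vector_derivative u' x) (at x)"
      by (simp add: has_real_derivative_iff_has_vector_derivative)
    have "(u' has_real_derivative u'' x) (at x)"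
      unfolding u'_def[abs_def] u''_def using T
      by (auto intro!: derivative_eq_intros simp: power2_eq_square)
    then show "(u' has_vector_derivative u'' x) (at x)"
      by (simp add: has_real_derivative_iff_has_vector_derivative)
    show "continuous_on {- T..T} u''" unfolding u''_def using T by (intro continuous_intros) auto
    show "0 \<le> u x" by (simp add: u_def)
    have "pi * (- T) / (2 * T) = - (pi / 2)" "pi * T / (2 * T) = pi / 2" "pi * (- T) / T = - pi" "pi * T / T = pi"
      using T by auto
    then show "u (- T) = 0" "u T = 0" "u' (- T) = 0" "u' T = 0"
      by (simp_all only: u_def u'_def) simp_all
    show "continuous_on {- b..b} w''"
      unfolding w''_def using cos_ge d by (intro continuous_intros) force+
    show "w (- b) = 0" "w b = 0" "w' (- b) = 0" "w' b = 0"
    proof -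
      have "d powr (a + 2) = d powr (a + 1) * d" "d powr 2 = d * d"
        using d by (simp_all add: powr_add power2_eq_square)
      then show "w (- b) = 0" "w b = 0" "w' (- b) = 0" "w' b = 0"
        unfolding w_def w'_def using b by (simp_all add: algebra_simps)
    qed
  next
    fix x assume x: "x \<in> {- b..b}"
    then have c: "cos x > 0" using cos_ge[OF x] d by linarith
    show "0 \<le> w x" by (rule w_nonneg[OF x])
    have "(w has_real_derivative w' x) (at x)"
      unfolding w_def w'_def using c by (auto intro!: derivative_eq_intros simp: algebra_simps)
    then show "(w has_vector_derivative w' x) (at x)"
      by (simp add: has_real_derivative_iff_has_vector_derivative)
    have "(w' has_real_derivative - (a + 2) * ((a + 1) * cos x powr a * (- sin x)) * sin x + (- (a + 2) * cos x powr (a + 1)) * cos x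
        + (a + 2) * d powr (a + 1) * cos x) (at x)"
      unfolding w'_def[abs_def] using c by (auto intro!: derivative_eq_intros simp: algebra_simps)
    also have "- (a + 2) * ((a + 1) * cos x powr a * (- sin x)) * sin x + (- (a + 2) * cos x powr (a + 1)) * cos x
        + (a + 2) * d powr (a + 1) * cos x = w'' x"
    proof -
      have "cos x powr (a + 1) = cos x powr a * cos x" "cos x powr (a + 2) = cos x powr a * (cos x * cos x)"
        using c by (simp_all add: powr_add powr_numeral power2_eq_square)
      moreover have "sin x * sin x = 1 - cos x * cos x"
        using sin_squared_eq[of x] by (simp add: power2_eq_square)
      ultimately show ?thesis unfolding w''_def by algebra
    qed
    finally show "(w' has_vector_derivative w'' x) (at x)"
      by (simp add: has_real_derivative_iff_has_vector_derivative)
  qed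
  show "\<bar>u (Re \<zeta>) * w'' (Im \<zeta>) + u'' (Re \<zeta>) * w (Im \<zeta>)\<bar> \<le>
       ((a + 2) * (2 * a + 4) + pi\<^sup>2 * (a + 2)) * cos (Im \<zeta>) powr a" if \<zeta>: "\<zeta> \<in> K" and "T \<ge> 1"
  proof -
    let ?c = "cos (Im \<zeta>)"
    have t: "Im \<zeta> \<in> {-b..b}" using \<zeta> unfolding K_def by (auto simp: cbox_Complex_eq)
    have c: "d \<le> ?c" "0 < ?c" "?c \<le> 1" using cos_ge[OF t] d by auto
    have p2: "?c powr (a + 2) \<le> ?c powr a" using c by (intro powr_mono') auto
    have p1: "d powr (a + 1) * ?c \<le> ?c powr a"
    proof -
      have "d powr (a + 1) * ?c \<le> ?c powr (a + 1) * ?c"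
        using a c d by (intro mult_right_mono powr_mono2) auto
      also have "\<dots> = ?c powr (a + 2)" using c by (simp add: powr_add power2_eq_square powr_numeral)
      finally show ?thesis using p2 by linarith
    qed
    have p3: "d powr (a + 2) \<le> ?c powr a"
      using a c d p2 powr_mono2[of "a + 2" d ?c] by auto
    have "\<bar>w'' (Im \<zeta>)\<bar> \<le> \<bar>(a + 2) * ((a + 1) * ?c powr a)\<bar> + \<bar>(a + 2) * ((a + 2) * ?c powr (a + 2))\<bar> + \<bar>(a + 2) * (d powr (a + 1) * ?c)\<bar>"
      unfolding w''_def by (simp add: algebra_simps abs_triangle_ineq4 abs_triangle_ineq)
    also have "\<dots> = (a + 2) * ((a + 1) * ?c powr a + (a + 2) * ?c powr (a + 2) + d powr (a + 1) * ?c)"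
    proof -
      have nn: "0 \<le> (a + 2) * ((a + 1) * ?c powr a)" "0 \<le> (a + 2) * ((a + 2) * ?c powr (a + 2))"
        "0 \<le> (a + 2) * (d powr (a + 1) * ?c)"
        using a c by auto
      show ?thesis unfolding nn[THEN abs_of_nonneg] by (simp only: distrib_left)
    qed
    also have "\<dots> \<le> (a + 2) * ((a + 1) * ?c powr a + (a + 2) * ?c powr a + ?c powr a)"
      using a p1 p2 by (intro mult_left_mono add_mono) auto
    also have "\<dots> = (a + 2) * (2 * a + 4) * ?c powr a" by (simp add: algebra_simps)
    finally have W'': "\<bar>w'' (Im \<zeta>)\<bar> \<le> (a + 2) * (2 * a + 4) * ?c powr a" .
    have "w (Im \<zeta>) \<le> ?c powr (a + 2) + (a + 1) * d powr (a + 2)"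
      unfolding w_def using a c by simp
    also have "\<dots> \<le> ?c powr a + (a + 1) * ?c powr a"
      using a p2 p3 by (intro add_mono mult_left_mono) auto
    finally have W: "\<bar>w (Im \<zeta>)\<bar> \<le> (a + 2) * ?c powr a"
      using w_nonneg[OF t] by (simp add: algebra_simps)
    have U: "\<bar>u (Re \<zeta>)\<bar> \<le> 1" unfolding u_def by (simp add: abs_square_le_1)
    have "T\<^sup>2 \<ge> 1" using \<open>T \<ge> 1\<close> by simp
    then have "pi\<^sup>2 / (2 * T\<^sup>2) \<le> pi\<^sup>2"
      by (simp add: divide_le_eq mult_le_cancel_left1)
    then have "\<bar>u'' (Re \<zeta>)\<bar> \<le> pi\<^sup>2 * 1"
      unfolding u''_def abs_mult by (intro mult_mono) auto
    then have "\<bar>u'' (Re \<zeta>) * w (Im \<zeta>)\<bar> \<le> pi\<^sup>2 * ((a + 2) * ?c powr a)"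
      unfolding abs_mult using W by (intro mult_mono) auto
    moreover have "\<bar>u (Re \<zeta>) * w'' (Im \<zeta>)\<bar> \<le> 1 * ((a + 2) * (2 * a + 4) * ?c powr a)"
      unfolding abs_mult using W'' U by (intro mult_mono) auto
    ultimately show ?thesis by (simp add: algebra_simps)
  qed
qed

text \<open>
  The limit of the cut-off inequality as the rectangles exhaust the strip.
\<close>

lemma strip_weight_comparison:
  fixes \<psi> :: "complex \<Rightarrow> complex"
  assumes a: "a > -1" and hol: "\<psi> holomorphic_on strip"
    and int: "set_integrable lborel strip (\<lambda>\<zeta>. (norm (\<psi> \<zeta>))\<^sup>2 * cos (Im \<zeta>) powr a)"
  shows "set_integrable lborel strip (\<lambda>\<zeta>. (norm (\<psi> \<zeta>))\<^sup>2 * cos (Im \<zeta>) powr (a + 2))"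
    and "(a + 2) * (LINT \<zeta>:strip|lborel. (norm (\<psi> \<zeta>))\<^sup>2 * cos (Im \<zeta>) powr (a + 2)) \<le>
      (a + 1) * (LINT \<zeta>:strip|lborel. (norm (\<psi> \<zeta>))\<^sup>2 * cos (Im \<zeta>) powr a)"
proof -
  have [measurable]: "strip \<in> sets borel" using open_strip by auto
  have \<psi>_cont: "continuous_on strip \<psi>" by (rule holomorphic_on_imp_continuous_on[OF hol])
  have cpow: "continuous_on strip (\<lambda>\<zeta>. cos (Im \<zeta>) powr c)" for c
    by (intro continuous_intros) (auto dest!: strip_cos_pos)
  have meas: "(\<lambda>\<zeta>. indicator S \<zeta> *\<^sub>R f \<zeta>) \<in> borel_measurable lborel"
    if "continuous_on S f" "S \<in> sets borel" for S and f :: "complex \<Rightarrow> real"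
    using borel_measurable_continuous_on_indicator[OF that(2,1)] by simp
  show int2: "set_integrable lborel strip (\<lambda>\<zeta>. (norm (\<psi> \<zeta>))\<^sup>2 * cos (Im \<zeta>) powr (a + 2))"
    using int unfolding set_integrable_def
  proof (rule Bochner_Integration.integrable_bound)
    show "(\<lambda>\<zeta>. indicator strip \<zeta> *\<^sub>R ((norm (\<psi> \<zeta>))\<^sup>2 * cos (Im \<zeta>) powr (a + 2))) \<in> borel_measurable lborel"
      by (intro meas continuous_intros \<psi>_cont cpow) auto
    show "AE \<zeta> in lborel. norm (indicat_real strip \<zeta> *\<^sub>R ((cmod (\<psi> \<zeta>))\<^sup>2 * cos (Im \<zeta>) powr (a + 2)))
         \<le> norm (indicat_real strip \<zeta> *\<^sub>R ((cmod (\<psi> \<zeta>))\<^sup>2 * cos (Im \<zeta>) powr a))"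
      by (intro always_eventually allI)
         (auto simp: indicator_def intro!: mult_left_mono powr_mono' dest!: strip_cos_pos)
  qed
  define d :: "nat \<Rightarrow> real" where "d n = 1 / (real n + 2)" for n
  define T :: "nat \<Rightarrow> real" where "T n = real n + 1" for n
  define K where "K n = cbox (Complex (- T n) (- arccos (d n))) (Complex (T n) (arccos (d n)))" for n
  define u where "u n = (\<lambda>s. (cos (pi * s / (2 * T n)))\<^sup>2)" for n
  define u'' where "u'' n = (\<lambda>s. - (pi\<^sup>2 / (2 * (T n)\<^sup>2)) * cos (pi * s / T n))" for n
  define w where "w n = (\<lambda>t. cos t powr (a + 2) - (a + 2) * d n powr (a + 1) * cos t + (a + 1) * d n powr (a + 2))" for n
  define w'' where "w'' n = (\<lambda>t. (a + 2) * ((a + 1) * cos t powr a - (a + 2) * cos t powr (a + 2)) + (a + 2) * d n powr (a + 1) * cos t)" for n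
  have dT: "0 < d n" "d n < 1" "0 < T n" "1 \<le> T n" for n by (auto simp: d_def T_def)
  note aux = strip_cutoff_laplacian[where d = "d n" and T = "T n" for n,
      OF a dT(1) dT(2) dT(3) hol, folded K_def]
  define L where "L n \<zeta> = u n (Re \<zeta>) * w'' n (Im \<zeta>) + u'' n (Re \<zeta>) * w n (Im \<zeta>)" for n \<zeta>
  define g where "g \<zeta> = (a + 2) * ((a + 1) * cos (Im \<zeta>) powr a - (a + 2) * cos (Im \<zeta>) powr (a + 2))" for \<zeta>
  define C where "C = (a + 2) * (2 * a + 4) + pi\<^sup>2 * (a + 2)"
  have d0: "d \<longlonglongrightarrow> 0" unfolding d_def by real_asymp
  have T0: "filterlim T at_top sequentially" unfolding T_def by real_asymp
  have lim: "(\<lambda>n. L n \<zeta>) \<longlonglongrightarrow> g \<zeta>" for \<zeta>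
  proof -
    have "(\<lambda>n. d n powr e) \<longlonglongrightarrow> 0" if "e > 0" for e
      using tendsto_powr'[OF d0 tendsto_const[of e]] that dT by (auto intro!: always_eventually less_imp_le)
    then have dl: "(\<lambda>n. d n powr (a + 1)) \<longlonglongrightarrow> 0" "(\<lambda>n. d n powr (a + 2)) \<longlonglongrightarrow> 0" using a by auto
    have "(\<lambda>n. u n s) \<longlonglongrightarrow> (cos 0)\<^sup>2" for s
    proof -
      have "(\<lambda>n. pi * s / (2 * T n)) \<longlonglongrightarrow> 0" unfolding T_def by real_asymp
      then show ?thesis unfolding u_def by (intro tendsto_intros)
    qed
    moreover have "(\<lambda>n. u'' n s) \<longlonglongrightarrow> - 0 * cos 0" for s
    proof -
      have "(\<lambda>n. pi * s / T n) \<longlonglongrightarrow> 0" "(\<lambda>n. pi\<^sup>2 / (2 * (T n)\<^sup>2)) \<longlonglongrightarrow> 0" unfolding T_def by real_asymp+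
      then show ?thesis unfolding u''_def by (intro tendsto_intros)
    qed
    moreover have "(\<lambda>n. w n t) \<longlonglongrightarrow> cos t powr (a + 2) - (a + 2) * 0 * cos t + (a + 1) * 0" for t
      unfolding w_def by (intro tendsto_intros dl)
    moreover have "(\<lambda>n. w'' n t) \<longlonglongrightarrow> (a + 2) * ((a + 1) * cos t powr a - (a + 2) * cos t powr (a + 2)) + (a + 2) * 0 * cos t" for t
      unfolding w''_def by (intro tendsto_intros dl)
    ultimately have "(\<lambda>n. L n \<zeta>) \<longlonglongrightarrow> (cos 0)\<^sup>2 * ((a + 2) * ((a + 1) * cos (Im \<zeta>) powr a - (a + 2) * cos (Im \<zeta>) powr (a + 2)) + (a + 2) * 0 * cos (Im \<zeta>))
      + (- 0 * cos 0) * (cos (Im \<zeta>) powr (a + 2) - (a + 2) * 0 * cos (Im \<zeta>) + (a + 1) * 0)"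
      unfolding L_def by (intro tendsto_add tendsto_mult)
    then show ?thesis by (simp add: g_def)
  qed
  have inK: "eventually (\<lambda>n. \<zeta> \<in> K n) sequentially" if "\<zeta> \<in> strip" for \<zeta>
  proof -
    have "eventually (\<lambda>n. d n < cos (Im \<zeta>)) sequentially"
      using order_tendstoD(2)[OF d0] strip_cos_pos[OF that] by blast
    moreover have "eventually (\<lambda>n. \<bar>Re \<zeta>\<bar> \<le> T n) sequentially"
      using T0 by (simp add: filterlim_at_top)
    ultimately show ?thesis
      by eventually_elim (use aux(2)[OF that] in auto)
  qed
  have "(\<lambda>n. LINT \<zeta>:K n|lborel. (norm (\<psi> \<zeta>))\<^sup>2 * L n \<zeta>) \<longlonglongrightarrow> (LINT \<zeta>:strip|lborel. (norm (\<psi> \<zeta>))\<^sup>2 * g \<zeta>)"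
    unfolding set_lebesgue_integral_def
  proof (rule integral_dominated_convergence)
    show "(\<lambda>\<zeta>. indicat_real strip \<zeta> *\<^sub>R ((norm (\<psi> \<zeta>))\<^sup>2 * g \<zeta>)) \<in> borel_measurable lborel"
      unfolding g_def by (intro meas continuous_intros \<psi>_cont cpow) auto
    show "(\<lambda>\<zeta>. indicat_real (K n) \<zeta> *\<^sub>R ((norm (\<psi> \<zeta>))\<^sup>2 * L n \<zeta>)) \<in> borel_measurable lborel" for n
    proof (rule meas)
      have "T n \<noteq> 0" using dT(3)[of n] by simp
      have "continuous_on strip (\<lambda>\<zeta>. w n (Im \<zeta>))" "continuous_on strip (\<lambda>\<zeta>. w'' n (Im \<zeta>))"
        unfolding w_def w''_def by (intro continuous_intros cpow)+
      moreover have "continuous_on strip (\<lambda>\<zeta>. u n (Re \<zeta>))" "continuous_on strip (\<lambda>\<zeta>. u'' n (Re \<zeta>))"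
        unfolding u_def u''_def using \<open>T n \<noteq> 0\<close> by (auto intro!: continuous_intros)
      ultimately have "continuous_on strip (\<lambda>\<zeta>. (norm (\<psi> \<zeta>))\<^sup>2 * L n \<zeta>)"
        unfolding L_def by (intro continuous_intros \<psi>_cont)
      then show "continuous_on (K n) (\<lambda>\<zeta>. (norm (\<psi> \<zeta>))\<^sup>2 * L n \<zeta>)"
        by (rule continuous_on_subset) (rule aux(1))
    qed (simp add: K_def)
    show "integrable lborel (\<lambda>\<zeta>. C * (indicat_real strip \<zeta> *\<^sub>R ((norm (\<psi> \<zeta>))\<^sup>2 * cos (Im \<zeta>) powr a)))"
      using int unfolding set_integrable_def by (intro integrable_mult_right)
    show "AE \<zeta> in lborel. (\<lambda>n. indicat_real (K n) \<zeta> *\<^sub>R ((norm (\<psi> \<zeta>))\<^sup>2 * L n \<zeta>)) \<longlonglongrightarrow>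
        indicat_real strip \<zeta> *\<^sub>R ((norm (\<psi> \<zeta>))\<^sup>2 * g \<zeta>)"
    proof (intro always_eventually allI)
      fix \<zeta>
      show "(\<lambda>n. indicat_real (K n) \<zeta> *\<^sub>R ((norm (\<psi> \<zeta>))\<^sup>2 * L n \<zeta>)) \<longlonglongrightarrow> indicat_real strip \<zeta> *\<^sub>R ((norm (\<psi> \<zeta>))\<^sup>2 * g \<zeta>)"
      proof (cases "\<zeta> \<in> strip")
        case True
        have "(\<lambda>n. (norm (\<psi> \<zeta>))\<^sup>2 * L n \<zeta>) \<longlonglongrightarrow> (norm (\<psi> \<zeta>))\<^sup>2 * g \<zeta>" by (intro tendsto_intros lim)
        moreover have "eventually (\<lambda>n. (norm (\<psi> \<zeta>))\<^sup>2 * L n \<zeta> = indicat_real (K n) \<zeta> *\<^sub>R ((norm (\<psi> \<zeta>))\<^sup>2 * L n \<zeta>)) sequentially"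
          using inK[OF True] by eventually_elim simp
        ultimately show ?thesis using True by (simp add: filterlim_cong[OF refl refl])
      next
        case False
        then have "\<zeta> \<notin> K n" for n using aux(1) by blast
        then show ?thesis using False by simp
      qed
    qed
    show "AE \<zeta> in lborel. norm (indicat_real (K n) \<zeta> *\<^sub>R ((norm (\<psi> \<zeta>))\<^sup>2 * L n \<zeta>)) \<le>
        C * (indicat_real strip \<zeta> *\<^sub>R ((norm (\<psi> \<zeta>))\<^sup>2 * cos (Im \<zeta>) powr a))" for n
    proof (intro always_eventually allI)
      fix \<zeta>
      have C: "C \<ge> 0" using a unfolding C_def by simp
      show "norm (indicat_real (K n) \<zeta> *\<^sub>R ((norm (\<psi> \<zeta>))\<^sup>2 * L n \<zeta>)) \<le>
        C * (indicat_real strip \<zeta> *\<^sub>R ((norm (\<psi> \<zeta>))\<^sup>2 * cos (Im \<zeta>) powr a))"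
      proof (cases "\<zeta> \<in> K n")
        case True
        then have "\<bar>L n \<zeta>\<bar> \<le> C * cos (Im \<zeta>) powr a"
          unfolding C_def L_def u_def u''_def w_def w''_def by (rule aux(4)[OF _ dT(4)])
        then have "(norm (\<psi> \<zeta>))\<^sup>2 * \<bar>L n \<zeta>\<bar> \<le> (norm (\<psi> \<zeta>))\<^sup>2 * (C * cos (Im \<zeta>) powr a)"
          by (rule mult_left_mono) simp
        moreover have "\<zeta> \<in> strip" using True aux(1) by blast
        ultimately show ?thesis using True by (simp add: abs_mult mult_ac)
      qed (use C in simp)
    qed
  qed
  moreover have "0 \<le> (LINT \<zeta>:K n|lborel. (norm (\<psi> \<zeta>))\<^sup>2 * L n \<zeta>)" for n
    unfolding L_def u_def u''_def w_def w''_def by (rule aux(3))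
  ultimately have "0 \<le> (LINT \<zeta>:strip|lborel. (norm (\<psi> \<zeta>))\<^sup>2 * g \<zeta>)"
    by (intro LIMSEQ_le_const) auto
  also have "\<dots> = (LINT \<zeta>:strip|lborel. (a + 2) * ((a + 1) * ((norm (\<psi> \<zeta>))\<^sup>2 * cos (Im \<zeta>) powr a) - (a + 2) * ((norm (\<psi> \<zeta>))\<^sup>2 * cos (Im \<zeta>) powr (a + 2))))"
    unfolding g_def by (simp add: algebra_simps)
  also have "\<dots> = (a + 2) * ((a + 1) * (LINT \<zeta>:strip|lborel. (norm (\<psi> \<zeta>))\<^sup>2 * cos (Im \<zeta>) powr a)
     - (a + 2) * (LINT \<zeta>:strip|lborel. (norm (\<psi> \<zeta>))\<^sup>2 * cos (Im \<zeta>) powr (a + 2)))"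
    using int int2 by simp
  finally show "(a + 2) * (LINT \<zeta>:strip|lborel. (norm (\<psi> \<zeta>))\<^sup>2 * cos (Im \<zeta>) powr (a + 2)) \<le>
      (a + 1) * (LINT \<zeta>:strip|lborel. (norm (\<psi> \<zeta>))\<^sup>2 * cos (Im \<zeta>) powr a)"
    using a by (simp add: zero_le_mult_iff)
qed

section \<open>The upper bound for the multiplier norm\<close>

lemma one_minus_sq_disk:
  assumes "z \<in> unit_disk"
  shows "1 - z\<^sup>2 \<noteq> 0" and "1 - z\<^sup>2 \<notin> \<real>\<^sub>\<le>\<^sub>0"
  using one_minus_mult_disk_nonzero[OF assms assms] unfolding power2_eq_square
  by (auto simp: complex_nonpos_Reals_iff)

lemma bergman_norm_nonneg: "a > -1 \<Longrightarrow> bergman_norm a \<phi> \<ge> 0"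
  unfolding bergman_norm_def set_lebesgue_integral_def
  by (intro real_sqrt_ge_zero mult_nonneg_nonneg Bochner_Integration.integral_nonneg) (auto simp: indicator_def)

lemma bergman_norm_sq:
  assumes "a > -1"
  shows "(bergman_norm a \<phi>)\<^sup>2 = (a + 1) / pi * (LINT z:unit_disk|lborel. (norm (\<phi> z))\<^sup>2 * (1 - (norm z)\<^sup>2) powr a)"
proof -
  have "(LINT z:unit_disk|lborel. (norm (\<phi> z))\<^sup>2 * (1 - (norm z)\<^sup>2) powr a) \<ge> 0"
    unfolding set_lebesgue_integral_def
    by (intro Bochner_Integration.integral_nonneg) (auto simp: indicator_def)
  then show ?thesis using assms unfolding bergman_norm_def by simp
qed

lemma bergman_cong:
  assumes "\<And>z. z \<in> unit_disk \<Longrightarrow> \<phi> z = \<phi>' z"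
  shows "\<phi> \<in> bergman_space a \<longleftrightarrow> \<phi>' \<in> bergman_space a" and "bergman_norm a \<phi> = bergman_norm a \<phi>'"
proof -
  show "\<phi> \<in> bergman_space a \<longleftrightarrow> \<phi>' \<in> bergman_space a"
  proof -
    have "\<phi> holomorphic_on unit_disk \<longleftrightarrow> \<phi>' holomorphic_on unit_disk"
      by (rule holomorphic_cong) (use assms in auto)
    moreover have "set_integrable lborel unit_disk (\<lambda>z. (norm (\<phi> z))\<^sup>2 * (1 - (norm z)\<^sup>2) powr a) \<longleftrightarrow>
        set_integrable lborel unit_disk (\<lambda>z. (norm (\<phi>' z))\<^sup>2 * (1 - (norm z)\<^sup>2) powr a)"
      by (rule set_integrable_cong) (use assms in auto)
    ultimately show ?thesis by (simp add: bergman_space_def)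
  qed
  show "bergman_norm a \<phi> = bergman_norm a \<phi>'"
    unfolding bergman_norm_def using assms
    by (intro arg_cong[where f = sqrt] arg_cong2[where f = "(*)"] set_lebesgue_integral_cong) auto
qed

lemma continuous_on_norm_sq_weight:
  assumes "\<phi> holomorphic_on unit_disk"
  shows "continuous_on unit_disk (\<lambda>z. (norm (\<phi> z))\<^sup>2 * (1 - (norm z)\<^sup>2) powr a)"
proof -
  have "1 - (norm z)\<^sup>2 \<noteq> 0" if "norm z < 1" for z :: complex
    using that by (simp add: abs_square_eq_1 power2_eq_1_iff) 
  then show ?thesis
    using assms by (intro continuous_intros holomorphic_on_imp_continuous_on) auto
qed

lemma bergman_mult_bounded:
  assumes a: "a > -1" and \<phi>: "\<phi> \<in> bergman_space a" and P: "P holomorphic_on unit_disk"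
    and M: "\<And>z. z \<in> unit_disk \<Longrightarrow> norm (P z) \<le> M"
  shows "(\<lambda>z. P z * \<phi> z) \<in> bergman_space a" and "(bergman_norm a (\<lambda>z. P z * \<phi> z))\<^sup>2 \<le> M\<^sup>2 * (bergman_norm a \<phi>)\<^sup>2"
proof -
  have hol: "(\<lambda>z. P z * \<phi> z) holomorphic_on unit_disk"
    using P \<phi> by (auto simp: bergman_space_def intro!: holomorphic_intros)
  have int: "set_integrable lborel unit_disk (\<lambda>z. M\<^sup>2 * ((norm (\<phi> z))\<^sup>2 * (1 - (norm z)\<^sup>2) powr a))"
    using \<phi> by (auto simp: bergman_space_def)
  have le: "(norm (P z * \<phi> z))\<^sup>2 * (1 - (norm z)\<^sup>2) powr a \<le> M\<^sup>2 * ((norm (\<phi> z))\<^sup>2 * (1 - (norm z)\<^sup>2) powr a)"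
    if "z \<in> unit_disk" for z
  proof -
    have "(norm (P z))\<^sup>2 \<le> M\<^sup>2" using M[OF that] by (intro power_mono) auto
    then show ?thesis by (simp add: norm_mult power_mult_distrib mult_right_mono mult.assoc)
  qed
  have int': "set_integrable lborel unit_disk (\<lambda>z. (norm (P z * \<phi> z))\<^sup>2 * (1 - (norm z)\<^sup>2) powr a)"
    using int unfolding set_integrable_def
  proof (rule Bochner_Integration.integrable_bound)
    show "(\<lambda>z. indicator unit_disk z *\<^sub>R ((norm (P z * \<phi> z))\<^sup>2 * (1 - (norm z)\<^sup>2) powr a)) \<in> borel_measurable lborel"
      using borel_measurable_continuous_on_indicator[OF _ continuous_on_norm_sq_weight[OF hol]] by simp
  qed (use le in \<open>auto simp: indicator_def abs_mult intro!: always_eventually\<close>)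
  then show "(\<lambda>z. P z * \<phi> z) \<in> bergman_space a"
    using hol by (simp add: bergman_space_def)
  have "(LINT z:unit_disk|lborel. (norm (P z * \<phi> z))\<^sup>2 * (1 - (norm z)\<^sup>2) powr a) \<le>
      (LINT z:unit_disk|lborel. M\<^sup>2 * ((norm (\<phi> z))\<^sup>2 * (1 - (norm z)\<^sup>2) powr a))"
    by (rule set_integral_mono[OF int' int le])
  then have "(a + 1) / pi * (LINT z:unit_disk|lborel. (norm (P z * \<phi> z))\<^sup>2 * (1 - (norm z)\<^sup>2) powr a) \<le>
     (a + 1) / pi * (M\<^sup>2 * (LINT z:unit_disk|lborel. (norm (\<phi> z))\<^sup>2 * (1 - (norm z)\<^sup>2) powr a))"
    using a by (intro mult_left_mono) auto
  then show "(bergman_norm a (\<lambda>z. P z * \<phi> z))\<^sup>2 \<le> M\<^sup>2 * (bergman_norm a \<phi>)\<^sup>2"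
    unfolding bergman_norm_sq[OF a] by (simp add: mult_ac)
qed

text \<open>
  The function \<open>\<psi>\<close> below represents \<open>\<phi>\<close> with exponent \<open>a\<close> and, at the same time,
  \<open>\<phi> / (1 - z\<^sup>2)\<close> with exponent \<open>a + 2\<close>. The strip inequality contributes
  \<open>(a + 1) / (a + 2)\<close>, the normalising constants of the two norms contribute
  \<open>(a + 3) / (a + 1)\<close>.
\<close>

lemma bergman_divide_one_minus_sq:
  assumes a: "a > -1" and \<phi>: "\<phi> \<in> bergman_space a"
  shows "(\<lambda>z. \<phi> z / (1 - z\<^sup>2)) \<in> bergman_space (a + 2)"
    and "(bergman_norm (a + 2) (\<lambda>z. \<phi> z / (1 - z\<^sup>2)))\<^sup>2 \<le> (a + 3) / (a + 2) * (bergman_norm a \<phi>)\<^sup>2"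
proof -
  have hol: "\<phi> holomorphic_on unit_disk"
    and int: "set_integrable lborel unit_disk (\<lambda>z. (norm (\<phi> z))\<^sup>2 * (1 - (norm z)\<^sup>2) powr a)"
    using \<phi> by (auto simp: bergman_space_def)
  have hol': "(\<lambda>z. \<phi> z / (1 - z\<^sup>2)) holomorphic_on unit_disk"
    using hol one_minus_sq_disk by (intro holomorphic_intros) auto
  define \<psi> where "\<psi> \<zeta> = \<phi> (strip_map \<zeta>) * (1 - (strip_map \<zeta>)\<^sup>2) powr of_real ((a + 2) / 2)" for \<zeta>
  have \<psi>: "\<psi> holomorphic_on strip"
    unfolding \<psi>_def
  proof (intro holomorphic_intros strip_map_holomorphic)
    show "(\<lambda>\<zeta>. \<phi> (strip_map \<zeta>)) holomorphic_on strip"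
      using holomorphic_on_compose_gen[OF strip_map_holomorphic hol] strip_map_image by (auto simp: o_def)
  qed (use strip_map_in_disk one_minus_sq_disk in blast)
  have n\<psi>: "(norm (\<psi> \<zeta>))\<^sup>2 = (norm (\<phi> (strip_map \<zeta>)))\<^sup>2 * norm (1 - (strip_map \<zeta>)\<^sup>2) powr (a + 2)"
    if "\<zeta> \<in> strip" for \<zeta>
  proof -
    have "norm ((1 - (strip_map \<zeta>)\<^sup>2) powr of_real ((a + 2) / 2)) = norm (1 - (strip_map \<zeta>)\<^sup>2) powr ((a + 2) / 2)"
      using one_minus_sq_disk(1)[OF strip_map_in_disk[OF that]] by (simp add: powr_def)
    moreover have "(norm (1 - (strip_map \<zeta>)\<^sup>2) powr ((a + 2) / 2))\<^sup>2 = norm (1 - (strip_map \<zeta>)\<^sup>2) powr (a + 2)"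
      by (simp add: power2_eq_square flip: powr_add)
    ultimately show ?thesis unfolding \<psi>_def by (simp add: norm_mult power_mult_distrib)
  qed
  have n': "(norm (\<phi> (strip_map \<zeta>) / (1 - (strip_map \<zeta>)\<^sup>2)))\<^sup>2 * norm (1 - (strip_map \<zeta>)\<^sup>2) powr (a + 2 + 2) = (norm (\<psi> \<zeta>))\<^sup>2"
    if "\<zeta> \<in> strip" for \<zeta>
  proof -
    have "norm (1 - (strip_map \<zeta>)\<^sup>2) > 0"
      using one_minus_sq_disk strip_map_in_disk[OF that] by auto
    then show ?thesis unfolding n\<psi>[OF that] powr_add[of _ "a + 2" 2]
      by (simp add: norm_divide power_divide)
  qed
  have c1: "continuous_on unit_disk (\<lambda>z. (norm (\<phi> z))\<^sup>2)"
    using hol by (intro continuous_intros holomorphic_on_imp_continuous_on)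
  have c2: "continuous_on unit_disk (\<lambda>z. (norm (\<phi> z / (1 - z\<^sup>2)))\<^sup>2)"
    using hol' by (intro continuous_on_power continuous_on_norm holomorphic_on_imp_continuous_on)
  have sm: "strip \<in> sets lborel" using open_strip by auto
  have e1: "set_integrable lborel strip (\<lambda>\<zeta>. (norm (\<phi> (strip_map \<zeta>)))\<^sup>2 * norm (1 - (strip_map \<zeta>)\<^sup>2) powr (a + 2) * cos (Im \<zeta>) powr a)
      \<longleftrightarrow> set_integrable lborel strip (\<lambda>\<zeta>. (norm (\<psi> \<zeta>))\<^sup>2 * cos (Im \<zeta>) powr a)"
    by (rule set_integrable_cong) (use n\<psi> in auto)
  have e2: "set_integrable lborel strip (\<lambda>\<zeta>. (norm (\<phi> (strip_map \<zeta>) / (1 - (strip_map \<zeta>)\<^sup>2)))\<^sup>2 * norm (1 - (strip_map \<zeta>)\<^sup>2) powr (a + 2 + 2) * cos (Im \<zeta>) powr (a + 2))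
      \<longleftrightarrow> set_integrable lborel strip (\<lambda>\<zeta>. (norm (\<psi> \<zeta>))\<^sup>2 * cos (Im \<zeta>) powr (a + 2))"
    by (rule set_integrable_cong) (use n' in auto)
  have int\<psi>: "set_integrable lborel strip (\<lambda>\<zeta>. (norm (\<psi> \<zeta>))\<^sup>2 * cos (Im \<zeta>) powr a)"
    using int weighted_disk_integral_strip(1)[OF c1] e1 by blast
  note ineq = strip_weight_comparison[OF a \<psi> int\<psi>]
  have int': "set_integrable lborel unit_disk (\<lambda>z. (norm (\<phi> z / (1 - z\<^sup>2)))\<^sup>2 * (1 - (norm z)\<^sup>2) powr (a + 2))"
    using ineq(1) weighted_disk_integral_strip(1)[OF c2, of "a + 2"] e2 by blast
  then show "(\<lambda>z. \<phi> z / (1 - z\<^sup>2)) \<in> bergman_space (a + 2)"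
    using hol' by (simp add: bergman_space_def)
  have I1: "(LINT z:unit_disk|lborel. (norm (\<phi> z))\<^sup>2 * (1 - (norm z)\<^sup>2) powr a) =
      (LINT \<zeta>:strip|lborel. (norm (\<psi> \<zeta>))\<^sup>2 * cos (Im \<zeta>) powr a) / 4"
    unfolding weighted_disk_integral_strip(2)[OF c1 int]
    by (intro arg_cong2[where f = "(/)"] set_lebesgue_integral_cong sm) (use n\<psi> in auto)
  have I2: "(LINT z:unit_disk|lborel. (norm (\<phi> z / (1 - z\<^sup>2)))\<^sup>2 * (1 - (norm z)\<^sup>2) powr (a + 2)) =
      (LINT \<zeta>:strip|lborel. (norm (\<psi> \<zeta>))\<^sup>2 * cos (Im \<zeta>) powr (a + 2)) / 4"
    unfolding weighted_disk_integral_strip(2)[OF c2 int']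
    by (intro arg_cong2[where f = "(/)"] set_lebesgue_integral_cong sm) (use n' in auto)
  have a2: "a + 2 > -1" using a by simp
  let ?J0 = "LINT \<zeta>:strip|lborel. (norm (\<psi> \<zeta>))\<^sup>2 * cos (Im \<zeta>) powr a"
  let ?J1 = "LINT \<zeta>:strip|lborel. (norm (\<psi> \<zeta>))\<^sup>2 * cos (Im \<zeta>) powr (a + 2)"
  have "?J1 \<le> (a + 1) / (a + 2) * ?J0"
    using ineq(2) a by (simp add: field_simps)
  then have "(a + 3) / pi * (?J1 / 4) \<le> (a + 3) / pi * (((a + 1) / (a + 2) * ?J0) / 4)"
    using a by (intro mult_left_mono divide_right_mono) auto
  also have "\<dots> = (a + 3) / (a + 2) * ((a + 1) / pi * (?J0 / 4))" by simp
  finally show "(bergman_norm (a + 2) (\<lambda>z. \<phi> z / (1 - z\<^sup>2)))\<^sup>2 \<le> (a + 3) / (a + 2) * (bergman_norm a \<phi>)\<^sup>2"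
    unfolding bergman_norm_sq[OF a] bergman_norm_sq[OF a2] I1 I2 by (simp add: add.commute add.left_commute)
qed

lemma bergman_divide_one_minus_sq_power:
  assumes a: "a > -1" and \<phi>: "\<phi> \<in> bergman_space a"
  shows "(\<lambda>z. \<phi> z / (1 - z\<^sup>2) ^ k) \<in> bergman_space (a + 2 * real k) \<and>
    (bergman_norm (a + 2 * real k) (\<lambda>z. \<phi> z / (1 - z\<^sup>2) ^ k))\<^sup>2 \<le>
      (\<Prod>j<k. (a + 2 * real j + 3) / (a + 2 * real j + 2)) * (bergman_norm a \<phi>)\<^sup>2"
proof (induction k)
  case 0
  then show ?case using \<phi> by simp
next
  case (Suc k)
  let ?a = "a + 2 * real k" and ?R = "\<Prod>j<k. (a + 2 * real j + 3) / (a + 2 * real j + 2)"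
  have a': "?a > -1" using a by linarith
  have eq: "\<phi> z / (1 - z\<^sup>2) ^ k / (1 - z\<^sup>2) = \<phi> z / (1 - z\<^sup>2) ^ Suc k" for z
    by (simp add: mult.commute)
  have eqa: "?a + 2 = a + 2 * real (Suc k)" by simp
  note step = bergman_divide_one_minus_sq[OF a' conjunct1[OF Suc], unfolded eq eqa]
  have "(bergman_norm (a + 2 * real (Suc k)) (\<lambda>z. \<phi> z / (1 - z\<^sup>2) ^ Suc k))\<^sup>2
      \<le> (?a + 3) / (a + 2 * real (Suc k)) * (bergman_norm ?a (\<lambda>z. \<phi> z / (1 - z\<^sup>2) ^ k))\<^sup>2"
    by (rule step(2))
  also have "\<dots> \<le> (?a + 3) / (a + 2 * real (Suc k)) * (?R * (bergman_norm a \<phi>)\<^sup>2)"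
    using a by (intro mult_left_mono conjunct2[OF Suc]) auto
  also have "\<dots> = (\<Prod>j<Suc k. (a + 2 * real j + 3) / (a + 2 * real j + 2)) * (bergman_norm a \<phi>)\<^sup>2"
    by (simp add: algebra_simps)
  finally show ?case using step(1) by simp
qed

text \<open>
  Passing from \<open>k\<close> to \<open>k + 1\<close> shifts the argument of the first Gamma factor by \<open>2\<close> and that of the
  squared one by \<open>1\<close>. With \<open>x = a + 2 + 2 k\<close> the functional equation gives
  \<open>x (x + 1) / (4 (x / 2)\<^sup>2) = (x + 1) / x\<close>.
\<close>

lemma Gamma_quotient_eq_prod:
  fixes a :: real
  assumes "a > -1"
  shows "Gamma (a + 2 + 2 * real k) / Gamma (a + 2) * (Gamma (a / 2 + 1) / Gamma (a / 2 + 1 + real k))\<^sup>2 / 2 ^ (2 * k) =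
    (\<Prod>j<k. (a + 2 * real j + 3) / (a + 2 * real j + 2))"
proof (induction k)
  case 0
  have "Gamma (a + 2) > 0" "Gamma (a / 2 + 1) > 0" using assms by (auto intro!: Gamma_real_pos)
  then show ?case by simp
next
  case (Suc k)
  let ?x = "a + 2 + 2 * real k" and ?y = "a / 2 + 1 + real k"
  have x: "?x > 0" and y: "?y > 0" using assms by auto
  have notin: "z \<notin> \<int>\<^sub>\<le>\<^sub>0" if "z > 0" for z :: real
    using that nonpos_Ints_nonpos by fastforce
  have "Gamma (?x + 1) = ?x * Gamma ?x" by (rule Gamma_plus1) (rule notin[OF x])
  moreover have "Gamma (?x + 1 + 1) = (?x + 1) * Gamma (?x + 1)"
    by (rule Gamma_plus1) (rule notin, use x in linarith)
  ultimately have "Gamma (?x + 1 + 1) = (?x + 1) * (?x * Gamma ?x)" by (simp only:)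
  then have G1: "Gamma (a + 2 + 2 * real (Suc k)) = (?x + 1) * (?x * Gamma ?x)"
    by (simp add: algebra_simps)
  have "Gamma (?y + 1) = ?y * Gamma ?y" by (rule Gamma_plus1) (rule notin[OF y])
  then have G2: "Gamma (a / 2 + 1 + real (Suc k)) = ?y * Gamma ?y"
    by (simp add: algebra_simps)
  have pos: "Gamma ?y > 0" "Gamma (a + 2) > 0" using assms by (auto intro!: Gamma_real_pos)
  have xy: "?x = 2 * ?y" by simp
  have "Gamma (a + 2 + 2 * real (Suc k)) / Gamma (a + 2) * (Gamma (a / 2 + 1) / Gamma (a / 2 + 1 + real (Suc k)))\<^sup>2 / 2 ^ (2 * Suc k)
     = (?x + 1) / ?x * (Gamma ?x / Gamma (a + 2) * (Gamma (a / 2 + 1) / Gamma ?y)\<^sup>2 / 2 ^ (2 * k))"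
  proof -
    have "(2 * y + 1) * (2 * y * A) / B * (C / (y * D))\<^sup>2 / 2 ^ (2 * Suc k) =
        (2 * y + 1) / (2 * y) * (A / B * (C / D)\<^sup>2 / 2 ^ (2 * k))"
      if "y \<noteq> 0" "B \<noteq> 0" "D \<noteq> 0" for y A B C D :: real
      using that by (simp add: field_simps power2_eq_square)
    from this[of ?y "Gamma (a + 2)" "Gamma ?y" "Gamma ?x" "Gamma (a / 2 + 1)"] y pos
    show ?thesis unfolding G1 G2 xy by simp
  qed
  also have "\<dots> = (?x + 1) / ?x * (\<Prod>j<k. (a + 2 * real j + 3) / (a + 2 * real j + 2))"
    unfolding Suc.IH ..
  also have "\<dots> = (\<Prod>j<Suc k. (a + 2 * real j + 3) / (a + 2 * real j + 2))"
    by (simp add: algebra_simps)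
  finally show ?case .
qed

section \<open>Integrals over the strip\<close>

definition cos_integral :: "real \<Rightarrow> real" where
  "cos_integral a = (LINT t:{- (pi / 2)..pi / 2}|lborel. cos t powr a)"

text \<open>
  The derivative of \<open>cos t powr (a + 1) * sin t\<close> is
  \<open>(a + 2) * cos t powr (a + 2) - (a + 1) * cos t powr a\<close>, and the function itself vanishes at both
  ends. The fundamental theorem of calculus for the gauge integral asks for no integrability of the
  derivative, so this yields the recursion and, for \<open>a < 0\<close>, also the integrability of the unbounded function \<open>cos t powr a\<close>.
\<close>

lemma set_integrable_cos_powr:
  assumes a: "a > -1"
  shows "set_integrable lborel {- (pi / 2)..pi / 2} (\<lambda>t. cos t powr a)"
    and "(a + 2) * cos_integral (a + 2) = (a + 1) * cos_integral a"
proof -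
  let ?I = "{- (pi / 2)..pi / 2}"
  have c0: "cos t \<ge> 0" if "t \<in> ?I" for t
    using that by (intro cos_ge_zero) auto
  have cont: "continuous_on ?I (\<lambda>t. cos t powr c)" if "c > 0" for c
    using c0 that by (intro continuous_on_powr' continuous_intros) auto
  have int2: "set_integrable lborel ?I (\<lambda>t. cos t powr (a + 2))"
    using borel_integrable_compact[of ?I "\<lambda>t. cos t powr (a + 2)"] cont[of "a + 2"] a
    by (simp add: set_integrable_def)
  have F: "((\<lambda>t. (a + 2) * cos t powr (a + 2) - (a + 1) * cos t powr a) has_integral
      (cos (pi / 2) powr (a + 1) * sin (pi / 2) - cos (- (pi / 2)) powr (a + 1) * sin (- (pi / 2)))) ?I"
  proof (rule fundamental_theorem_of_calculus_interior)
    show "continuous_on ?I (\<lambda>t. cos t powr (a + 1) * sin t)"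
      using a by (intro continuous_intros cont) auto
    fix t assume t: "t \<in> {- (pi / 2)<..<pi / 2}"
    then have c: "cos t > 0" by (intro cos_gt_zero_pi) auto
    have "((\<lambda>t. cos t powr (a + 1) * sin t) has_real_derivative
        (a + 1) * cos t powr a * (- sin t) * sin t + cos t powr (a + 1) * cos t) (at t)"
      using c by (auto intro!: derivative_eq_intros simp: algebra_simps)
    also have "(a + 1) * cos t powr a * (- sin t) * sin t + cos t powr (a + 1) * cos t =
        (a + 2) * cos t powr (a + 2) - (a + 1) * cos t powr a"
    proof -
      have "cos t powr (a + 1) = cos t powr a * cos t" "cos t powr (a + 2) = cos t powr a * (cos t * cos t)"
        using c by (simp_all add: powr_add power2_eq_square)
      moreover have "sin t * sin t = 1 - cos t * cos t"
        using sin_squared_eq[of t] by (simp add: power2_eq_square)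
      ultimately show ?thesis by algebra
    qed
    finally show "((\<lambda>t. cos t powr (a + 1) * sin t) has_vector_derivative
        (a + 2) * cos t powr (a + 2) - (a + 1) * cos t powr a) (at t)"
      by (simp add: has_real_derivative_iff_has_vector_derivative)
  qed simp
  then have F: "((\<lambda>t. (a + 2) * cos t powr (a + 2) - (a + 1) * cos t powr a) has_integral 0) ?I"
    by simp
  have G: "((\<lambda>t. (a + 2) * cos t powr (a + 2)) has_integral (a + 2) * cos_integral (a + 2)) ?I"
    unfolding cos_integral_def using set_borel_integral_eq_integral[OF int2]
    by (intro has_integral_mult_right) (metis integrable_integral)
  have "((\<lambda>t. 1 / (a + 1) * ((a + 2) * cos t powr (a + 2) - ((a + 2) * cos t powr (a + 2) - (a + 1) * cos t powr a)))
      has_integral 1 / (a + 1) * ((a + 2) * cos_integral (a + 2) - 0)) ?I"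
    by (intro has_integral_mult_right has_integral_diff G F)
  moreover have "(\<lambda>t. 1 / (a + 1) * ((a + 2) * cos t powr (a + 2) - ((a + 2) * cos t powr (a + 2) - (a + 1) * cos t powr a))) =
      (\<lambda>t. cos t powr a)"
    using a by (simp add: fun_eq_iff)
  ultimately have H: "((\<lambda>t. cos t powr a) has_integral (a + 2) * cos_integral (a + 2) / (a + 1)) ?I"
    by simp
  then have "(\<lambda>t. cos t powr a) absolutely_integrable_on ?I"
    by (intro nonnegative_absolutely_integrable_1) auto
  moreover have "(\<lambda>t. indicator ?I t *\<^sub>R cos t powr a) \<in> borel_measurable lborel"
    by measurable
  ultimately show int: "set_integrable lborel ?I (\<lambda>t. cos t powr a)"
    unfolding set_integrable_def using integrable_completion by blast
  have "cos_integral a = (a + 2) * cos_integral (a + 2) / (a + 1)"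
    unfolding cos_integral_def using set_borel_integral_eq_integral(2)[OF int] integral_unique[OF H]
    by (simp add: cos_integral_def)
  then show "(a + 2) * cos_integral (a + 2) = (a + 1) * cos_integral a"
    using a by simp
qed

lemma cos_integral_pos:
  assumes a: "a > -1"
  shows "cos_integral a > 0"
proof -
  let ?I = "{- (pi / 2)..pi / 2}"
  have nn: "cos_integral c \<ge> 0" for c
    unfolding cos_integral_def set_lebesgue_integral_def
    by (intro Bochner_Integration.integral_nonneg) (auto simp: indicator_def)
  have cont: "continuous_on (cbox (- (pi / 2)) (pi / 2)) (\<lambda>t. cos t powr (a + 2))"
    using a by (intro continuous_on_powr' continuous_intros) (auto intro!: cos_ge_zero)
  \<comment> \<open>The exponent \<open>a + 2\<close> is positive, which makes the integrand continuous on the closed interval.\<close>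
  have "cos_integral (a + 2) \<noteq> 0"
  proof
    assume "cos_integral (a + 2) = 0"
    then have "((\<lambda>t. cos t powr (a + 2)) has_integral 0) (cbox (- (pi / 2)) (pi / 2))"
      using set_borel_integral_eq_integral[OF set_integrable_cos_powr(1)[of "a + 2"]] a
      unfolding cos_integral_def by (simp add: has_integral_iff)
    from has_integral_0_cbox_imp_0[OF cont _ this, of 0] pi_gt_zero show False by (auto simp: not_le)
  qed
  then have "cos_integral (a + 2) > 0" using nn[of "a + 2"] by simp
  then have "(a + 2) * cos_integral (a + 2) > 0" using a by simp
  then have "(a + 1) * cos_integral a > 0" using set_integrable_cos_powr(2)[OF a] by simp
  then show ?thesis using a nn[of a] by (simp add: zero_less_mult_iff)
qed

text \<open>
  The sharp constant of the upper bound is the ratio of these integrals. This is what a constant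
  \<open>\<psi>\<close> would give.
\<close>

lemma cos_integral_shift:
  assumes a: "a > -1"
  shows "(a + 2 * real k + 1) * cos_integral (a + 2 * real k) =
    (\<Prod>j<k. (a + 2 * real j + 3) / (a + 2 * real j + 2)) * ((a + 1) * cos_integral a)"
proof (induction k)
  case (Suc k)
  let ?b = "a + 2 * real k"
  have "?b > -1" using a by linarith
  then have "(?b + 2) * cos_integral (?b + 2) = (?b + 1) * cos_integral ?b"
    by (rule set_integrable_cos_powr(2))
  then have "(?b + 3) * cos_integral (?b + 2) = (?b + 3) / (?b + 2) * ((?b + 1) * cos_integral ?b)"
    using \<open>?b > -1\<close> by (simp add: field_simps)
  also have "\<dots> = (\<Prod>j<Suc k. (a + 2 * real j + 3) / (a + 2 * real j + 2)) * ((a + 1) * cos_integral a)"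
    unfolding Suc.IH by simp
  finally show ?case by (simp add: algebra_simps)
qed simp

lemma strip_product_integral:
  fixes f :: "real \<Rightarrow> real"
  assumes a: "a > -1" and f: "integrable lborel f"
  shows "set_integrable lborel strip (\<lambda>\<zeta>. f (Re \<zeta>) * cos (Im \<zeta>) powr a)"
    and "(LINT \<zeta>:strip|lborel. f (Re \<zeta>) * cos (Im \<zeta>) powr a) = (LINT s|lborel. f s) * cos_integral a"
proof -
  define g where "g t = indicator {- (pi / 2)..pi / 2} t *\<^sub>R cos t powr a" for t :: real
  have g: "integrable lborel g"
    using set_integrable_cos_powr(1)[OF a] unfolding set_integrable_def g_def .
  have [measurable]: "f \<in> borel_measurable borel" "g \<in> borel_measurable borel"
    using f g by (auto dest: borel_measurable_integrable)
  \<comment> \<open>The closed interval may replace the open one since \<open>0 powr a = 0\<close> at its ends, even for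
     \<open>a \<le> 0\<close>.\<close>
  have eq: "indicator strip (Complex s t) * (f s * cos t powr a) = f s * g t" for s t
  proof (cases "\<bar>t\<bar> = pi / 2")
    case True
    then have "cos t = 0" using cos_abs_real[of t] by (metis cos_pi_half)
    then show ?thesis by (simp add: g_def)
  qed (auto simp: g_def strip_def indicator_def)
  have meas: "(\<lambda>(x, y). Complex x y) \<in> (lborel \<Otimes>\<^sub>M lborel) \<rightarrow>\<^sub>M borel"
    unfolding lborel_prod by simp (intro borel_measurable_continuous_onI, auto simp: split_beta intro!: continuous_intros)
  have prod: "integrable (lborel \<Otimes>\<^sub>M lborel) (\<lambda>p. f (fst p) * g (snd p))"
    by (rule lborel_pair.Fubini_integrable) (use f g in \<open>auto simp: abs_mult\<close>)
  have F: "(\<lambda>\<zeta>. indicator strip \<zeta> *\<^sub>R (f (Re \<zeta>) * cos (Im \<zeta>) powr a)) \<in> borel_measurable borel"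
    using open_strip by (intro borel_measurable_scaleR borel_measurable_indicator) auto
  show "set_integrable lborel strip (\<lambda>\<zeta>. f (Re \<zeta>) * cos (Im \<zeta>) powr a)"
    unfolding set_integrable_def lborel_complex_eq_prod
    by (subst integrable_distr_eq[OF meas F]) (use prod in \<open>simp add: split_beta eq\<close>)
  have "(LINT \<zeta>:strip|lborel. f (Re \<zeta>) * cos (Im \<zeta>) powr a) = (LINT p|(lborel \<Otimes>\<^sub>M lborel). f (fst p) * g (snd p))"
    unfolding set_lebesgue_integral_def lborel_complex_eq_prod
    by (subst integral_distr[OF meas F]) (simp add: split_beta eq)
  also have "\<dots> = (LINT s|lborel. (LINT t|lborel. f s * g t))"
    using lborel_pair.integral_fst'[OF prod] by simp
  also have "\<dots> = (LINT s|lborel. f s) * (LINT t|lborel. g t)" by simp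
  finally show "(LINT \<zeta>:strip|lborel. f (Re \<zeta>) * cos (Im \<zeta>) powr a) = (LINT s|lborel. f s) * cos_integral a"
    unfolding g_def cos_integral_def set_lebesgue_integral_def .
qed

lemma integral_exp_minus_abs:
  fixes c :: real
  assumes "c > 0"
  shows "integrable lborel (\<lambda>s. exp (- c * \<bar>s\<bar>))" and "(LINT s|lborel. exp (- c * \<bar>s\<bar>)) = 2 / c"
proof -
  define h where "h s = indicator {0..} s *\<^sub>R exp (- c * s)" for s :: real
  have "(\<lambda>s. exp (- c * s)) absolutely_integrable_on {0..}"
    using integrable_on_exp_minus_to_infinity[OF assms] by (intro nonnegative_absolutely_integrable_1) auto
  then have hi: "integrable lborel h"
    unfolding set_integrable_def h_def[abs_def] by (rule integrable_completion[THEN iffD1, rotated]) measurable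
  then have "(LINT s|lborel. h s) = integral {0..} (\<lambda>s. exp (- c * s))"
    using set_borel_integral_eq_integral(2)[of "{0..}" "\<lambda>s. exp (- c * s)"]
    unfolding set_integrable_def h_def set_lebesgue_integral_def by simp
  also have "\<dots> = 1 / c"
    using integral_unique[OF has_integral_exp_minus_to_infinity[OF assms, of 0]] by simp
  finally have h: "(LINT s|lborel. h s) = 1 / c" .
  have hi': "integrable lborel (\<lambda>s. h (- s))"
    using lborel_integrable_real_affine[OF hi, of "-1" 0] by simp
  have h': "(LINT s|lborel. h (- s)) = 1 / c"
    using lborel_integral_real_affine[of "-1" h 0] h by simp
  have ae: "AE s in lborel. h s + h (- s) = exp (- c * \<bar>s\<bar>)"
    using AE_lborel_singleton[of 0] by eventually_elim (auto simp: h_def indicator_def)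
  have m: "(\<lambda>s. exp (- c * \<bar>s\<bar>)) \<in> borel_measurable lborel" by measurable
  show "integrable lborel (\<lambda>s. exp (- c * \<bar>s\<bar>))"
    by (rule integrable_cong_AE_imp[OF Bochner_Integration.integrable_add[OF hi hi'] m]) (use ae in auto)
  have "(LINT s|lborel. exp (- c * \<bar>s\<bar>)) = (LINT s|lborel. h s + h (- s))"
    by (rule integral_cong_AE[OF m]) (use ae hi hi' in \<open>auto dest: borel_measurable_integrable\<close>)
  also have "\<dots> = 2 / c" using hi hi' h h' by simp
  finally show "(LINT s|lborel. exp (- c * \<bar>s\<bar>)) = 2 / c" .
qed

text \<open>
  The whole integral is \<open>2 / c\<close>, and the part with \<open>\<bar>s\<bar> < T\<close> is at most \<open>2 T\<close>, because the
  integrand is at most \<open>1\<close>.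
\<close>

lemma integral_exp_minus_abs_tail:
  fixes c T :: real
  assumes "c > 0" "T \<ge> 0"
  shows "integrable lborel (\<lambda>s. indicator {s. \<bar>s\<bar> \<ge> T} s * exp (- c * \<bar>s\<bar>))"
    and "(LINT s|lborel. indicator {s. \<bar>s\<bar> \<ge> T} s * exp (- c * \<bar>s\<bar>)) \<ge> 2 / c - 2 * T"
proof -
  note e = integral_exp_minus_abs[OF assms(1)]
  have [measurable]: "{s. \<bar>s\<bar> \<ge> T} \<in> sets borel" by measurable
  show i: "integrable lborel (\<lambda>s. indicator {s. \<bar>s\<bar> \<ge> T} s * exp (- c * \<bar>s\<bar>))"
    using integrable_mult_indicator[OF _ e(1), of "{s. \<bar>s\<bar> \<ge> T}"] by simp
  have ii: "integrable lborel (\<lambda>s. indicator {-T..T} s :: real)"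
    by (intro integrable_real_indicator) (auto simp: emeasure_lborel_Icc_eq)
  have "2 / c \<le> (LINT s|lborel. indicator {s. \<bar>s\<bar> \<ge> T} s * exp (- c * \<bar>s\<bar>) + indicator {-T..T} s)"
    unfolding e(2)[symmetric]
  proof (rule integral_mono[OF e(1) Bochner_Integration.integrable_add[OF i ii]])
    show "exp (- c * \<bar>s\<bar>) \<le> indicator {s. \<bar>s\<bar> \<ge> T} s * exp (- c * \<bar>s\<bar>) + indicator {-T..T} s" for s
      using assms by (cases "\<bar>s\<bar> \<ge> T") (auto simp: indicator_def)
  qed
  also have "\<dots> = (LINT s|lborel. indicator {s. \<bar>s\<bar> \<ge> T} s * exp (- c * \<bar>s\<bar>)) + 2 * T"
    using i ii assms(2) by simp
  finally show "(LINT s|lborel. indicator {s. \<bar>s\<bar> \<ge> T} s * exp (- c * \<bar>s\<bar>)) \<ge> 2 / c - 2 * T" by simp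
qed

text \<open>
  Far out in the strip \<open>strip_map\<close> is uniformly close to \<open>1\<close> or to \<open>-1\<close>, the distance being at
  most \<open>2 exp (- \<bar>Re \<zeta>\<bar>)\<close>.
\<close>

lemma strip_map_near_ends:
  assumes P: "continuous_on UNIV P" and "norm (P 1) = Q" "norm (P (-1)) = Q" and "\<delta> > (0::real)"
  obtains T where "T > 0" and "\<And>\<zeta>. \<zeta> \<in> strip \<Longrightarrow> \<bar>Re \<zeta>\<bar> \<ge> T \<Longrightarrow> norm (P (strip_map \<zeta>)) \<ge> Q - \<delta>"
proof -
  have ev: "\<exists>r>0. \<forall>z. dist z e < r \<longrightarrow> norm (P z) \<ge> Q - \<delta>" if "norm (P e) = Q" for e :: complex
  proof -
    obtain r where "r > 0" "\<And>z. dist z e < r \<Longrightarrow> dist (P z) (P e) < \<delta>"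
      using P \<open>\<delta> > 0\<close> unfolding continuous_on_iff by (metis UNIV_I)
    moreover have "norm (P z) \<ge> Q - \<delta>" if "dist (P z) (P e) < \<delta>" for z
      using that norm_triangle_ineq2[of "P e" "P z"] \<open>norm (P e) = Q\<close> by (simp add: dist_norm norm_minus_commute)
    ultimately show ?thesis by blast
  qed
  obtain r where r: "r > 0" "\<And>z. dist z 1 < r \<Longrightarrow> norm (P z) \<ge> Q - \<delta>"
    using ev[of 1] assms by blast
  obtain r' where r': "r' > 0" "\<And>z. dist z (-1) < r' \<Longrightarrow> norm (P z) \<ge> Q - \<delta>"
    using ev[of "-1"] assms by blast
  define q where "q = min 1 (min r r')"
  have q: "0 < q" "q \<le> 1" "q \<le> r" "q \<le> r'" using r r' by (auto simp: q_def)
  \<comment> \<open>This makes the distance bound \<open>2 exp (- T) = 2 q / 3\<close>, which is less than \<open>q\<close>.\<close>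
  define T where "T = ln (3 / q)"
  have T: "T > 0" "2 * exp (- T) < q"
    unfolding T_def using q by (auto simp: exp_minus divide_simps intro!: ln_gt_zero)
  show thesis
  proof (rule that[OF \<open>T > 0\<close>])
    fix \<zeta> assume \<zeta>: "\<zeta> \<in> strip" and s: "\<bar>Re \<zeta>\<bar> \<ge> T"
    have re: "Re (exp \<zeta>) > 0" by (rule strip_Re_exp_pos[OF \<zeta>])
    have ne: "exp \<zeta> + 1 \<noteq> 0" by (rule strip_exp_plus_1_nonzero[OF \<zeta>])
    have ge1: "norm (exp \<zeta> + 1) \<ge> 1"
      using complex_Re_le_cmod[of "exp \<zeta> + 1"] re by simp
    have "(norm (exp \<zeta>))\<^sup>2 \<le> (norm (exp \<zeta> + 1))\<^sup>2"
      unfolding cmod_power2 using re by (simp add: power2_eq_square algebra_simps)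
    then have geu: "norm (exp \<zeta> + 1) \<ge> exp (Re \<zeta>)"
      by (simp add: norm_exp_eq_Re power2_le_iff_abs_le)
    show "norm (P (strip_map \<zeta>)) \<ge> Q - \<delta>"
    proof (cases "Re \<zeta> \<ge> 0")
      case True
      have "strip_map \<zeta> - 1 = - 2 / (exp \<zeta> + 1)"
        using ne by (simp add: strip_map_def divide_simps)
      then have "dist (strip_map \<zeta>) 1 = 2 / norm (exp \<zeta> + 1)" by (simp add: dist_norm norm_divide)
      also have "\<dots> \<le> 2 / exp (Re \<zeta>)" using geu ne by (intro divide_left_mono mult_pos_pos) auto
      also have "\<dots> = 2 * exp (- Re \<zeta>)" by (simp add: exp_minus divide_simps)
      also have "\<dots> \<le> 2 * exp (- T)" using True s by simp
      also have "\<dots> < r" using T q by linarith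
      finally show ?thesis by (rule r(2))
    next
      case False
      have "strip_map \<zeta> + 1 = 2 * exp \<zeta> / (exp \<zeta> + 1)"
        using ne by (simp add: strip_map_def divide_simps)
      then have "dist (strip_map \<zeta>) (-1) = 2 * exp (Re \<zeta>) / norm (exp \<zeta> + 1)"
        by (simp add: dist_norm norm_divide norm_mult)
      also have "\<dots> \<le> 2 * exp (Re \<zeta>)" using ge1 ne by (simp add: divide_le_eq)
      also have "\<dots> \<le> 2 * exp (- T)" using False s by simp
      also have "\<dots> < r'" using T q by linarith
      finally show ?thesis by (rule r'(2))
    qed
  qed
qed

section \<open>The lower bound and the multiplier norm\<close>

text \<open>
  In the strip this function corresponds to \<open>\<psi> = (1 - z\<^sup>2) powr e\<close>, a square integrable
  approximation of the constant \<open>1\<close>.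
\<close>

definition test_fun :: "real \<Rightarrow> real \<Rightarrow> complex \<Rightarrow> complex" where
  "test_fun a e z = (1 - z\<^sup>2) powr of_real (e - (a + 2) / 2)"

lemma test_fun_holomorphic: "test_fun a e holomorphic_on unit_disk"
  unfolding test_fun_def[abs_def] using one_minus_sq_disk(2) by (intro holomorphic_intros) auto

lemma test_fun_nonzero: "z \<in> unit_disk \<Longrightarrow> test_fun a e z \<noteq> 0"
  unfolding test_fun_def using one_minus_sq_disk(1) by (simp add: powr_def)

lemma norm_sq_test_fun:
  assumes "z \<in> unit_disk"
  shows "(norm (test_fun a e z))\<^sup>2 * norm (1 - z\<^sup>2) powr (a + 2) = norm (1 - z\<^sup>2) powr (2 * e)"
proof -
  have n: "norm (test_fun a e z) = norm (1 - z\<^sup>2) powr (e - (a + 2) / 2)"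
    unfolding test_fun_def using one_minus_sq_disk(1)[OF assms] by (simp add: powr_def)
  have "(norm (test_fun a e z))\<^sup>2 = norm (1 - z\<^sup>2) powr (2 * e - (a + 2))"
  proof -
    have "(e - (a + 2) / 2) + (e - (a + 2) / 2) = 2 * e - (a + 2)" by simp
    then show ?thesis by (simp only: n power2_eq_square powr_add[symmetric])
  qed
  then show ?thesis by (simp only: powr_add[symmetric]) simp
qed

lemma norm_sq_test_fun_divide:
  assumes "z \<in> unit_disk"
  shows "(norm (- P / (1 - z\<^sup>2) ^ k * test_fun a e z))\<^sup>2 * norm (1 - z\<^sup>2) powr (a + 2 * real k + 2) =
    (norm P)\<^sup>2 * norm (1 - z\<^sup>2) powr (2 * e)"
proof -
  let ?n = "norm (1 - z\<^sup>2)"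
  have n: "?n > 0" using one_minus_sq_disk(1)[OF assms] by simp
  have "?n powr (a + 2 * real k + 2) = ?n powr (a + 2) * ?n powr (real (2 * k))"
    by (simp add: algebra_simps flip: powr_add)
  also have "?n powr (real (2 * k)) = (?n ^ k)\<^sup>2"
    using n by (simp only: powr_realpow) (simp add: power_mult[symmetric] mult.commute)
  finally have "(norm (- P / (1 - z\<^sup>2) ^ k * test_fun a e z))\<^sup>2 * ?n powr (a + 2 * real k + 2) =
     (norm P)\<^sup>2 * ((norm (test_fun a e z))\<^sup>2 * ?n powr (a + 2))"
    using n by (simp add: norm_mult norm_divide norm_power power_mult_distrib power_divide)
  then show ?thesis unfolding norm_sq_test_fun[OF assms] .
qed

text \<open>
  The lower bound has integral \<open>1 / e\<close> over the real line, and the factor between the two bounds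
  tends to \<open>1\<close> as \<open>e\<close> tends to \<open>0\<close>; so the integral of the middle term is asymptotic to \<open>1 / e\<close>.
\<close>

lemma strip_map_powr_bounds:
  assumes "\<zeta> \<in> strip" and "e > 0"
  shows "norm (1 - (strip_map \<zeta>)\<^sup>2) powr (2 * e) \<le> 4 powr (2 * e) * exp (- (2 * e) * \<bar>Re \<zeta>\<bar>)"
    and "exp (- (2 * e) * \<bar>Re \<zeta>\<bar>) \<le> norm (1 - (strip_map \<zeta>)\<^sup>2) powr (2 * e)"
proof -
  have ex: "exp (- \<bar>Re \<zeta>\<bar>) powr (2 * e) = exp (- (2 * e) * \<bar>Re \<zeta>\<bar>)"
    by (simp add: powr_def)
  have "norm (1 - (strip_map \<zeta>)\<^sup>2) powr (2 * e) \<le> (4 * exp (- \<bar>Re \<zeta>\<bar>)) powr (2 * e)"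
    using norm_one_minus_strip_map_sq_bounds(1)[OF assms(1)] assms(2) by (intro powr_mono2) auto
  then show "norm (1 - (strip_map \<zeta>)\<^sup>2) powr (2 * e) \<le> 4 powr (2 * e) * exp (- (2 * e) * \<bar>Re \<zeta>\<bar>)"
    by (simp add: powr_mult ex)
  show "exp (- (2 * e) * \<bar>Re \<zeta>\<bar>) \<le> norm (1 - (strip_map \<zeta>)\<^sup>2) powr (2 * e)"
    unfolding ex[symmetric] using norm_one_minus_strip_map_sq_bounds(2)[OF assms(1)] assms(2)
    by (intro powr_mono2) auto
qed

lemma test_fun_bergman:
  assumes a: "a > -1" and e: "e > 0"
  shows "test_fun a e \<in> bergman_space a"
    and "(bergman_norm a (test_fun a e))\<^sup>2 \<le> (a + 1) / (4 * pi) * (4 powr (2 * e) * (1 / e) * cos_integral a)"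
proof -
  let ?h = "\<lambda>z. (norm (test_fun a e z))\<^sup>2"
  let ?v = "\<lambda>\<zeta>. norm (1 - (strip_map \<zeta>)\<^sup>2) powr (2 * e)"
  let ?u = "\<lambda>\<zeta>. 4 powr (2 * e) * (exp (- (2 * e) * \<bar>Re \<zeta>\<bar>) * cos (Im \<zeta>) powr a)"
  have c: "continuous_on unit_disk ?h"
    by (intro continuous_intros holomorphic_on_imp_continuous_on test_fun_holomorphic)
  have sm: "strip \<in> sets lborel" using open_strip by auto
  have sm_cont: "continuous_on strip strip_map"
    by (rule holomorphic_on_imp_continuous_on[OF strip_map_holomorphic])
  have E: "integrable lborel (\<lambda>s. exp (- (2 * e) * \<bar>s\<bar>))" "(LINT s|lborel. exp (- (2 * e) * \<bar>s\<bar>)) = 1 / e"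
    using integral_exp_minus_abs[of "2 * e"] e by auto
  note pr = strip_product_integral[OF a E(1)]
  have u_int: "set_integrable lborel strip ?u" using pr(1) by simp
  have le: "?v \<zeta> * cos (Im \<zeta>) powr a \<le> ?u \<zeta>" if "\<zeta> \<in> strip" for \<zeta>
    using mult_right_mono[OF strip_map_powr_bounds(1)[OF that e], of "cos (Im \<zeta>) powr a"] by (simp add: mult_ac)
  have v_int: "set_integrable lborel strip (\<lambda>\<zeta>. ?v \<zeta> * cos (Im \<zeta>) powr a)"
    using u_int unfolding set_integrable_def
  proof (rule Bochner_Integration.integrable_bound)
    have cv: "continuous_on strip (\<lambda>\<zeta>. ?v \<zeta> * cos (Im \<zeta>) powr a)"
      using one_minus_sq_disk(1)[OF strip_map_in_disk]
      by (intro continuous_intros sm_cont) (auto dest: strip_cos_pos)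
    show "(\<lambda>\<zeta>. indicator strip \<zeta> *\<^sub>R (?v \<zeta> * cos (Im \<zeta>) powr a)) \<in> borel_measurable lborel"
      using borel_measurable_continuous_on_indicator[OF _ cv] sm by simp
  qed (use le in \<open>auto simp: indicator_def abs_mult intro!: always_eventually\<close>)
  have cong: "?h (strip_map \<zeta>) * norm (1 - (strip_map \<zeta>)\<^sup>2) powr (a + 2) * cos (Im \<zeta>) powr a = ?v \<zeta> * cos (Im \<zeta>) powr a"
    if "\<zeta> \<in> strip" for \<zeta>
    using norm_sq_test_fun[OF strip_map_in_disk[OF that]] by simp
  have "set_integrable lborel strip (\<lambda>\<zeta>. ?h (strip_map \<zeta>) * norm (1 - (strip_map \<zeta>)\<^sup>2) powr (a + 2) * cos (Im \<zeta>) powr a)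
      \<longleftrightarrow> set_integrable lborel strip (\<lambda>\<zeta>. ?v \<zeta> * cos (Im \<zeta>) powr a)"
    by (rule set_integrable_cong) (use cong in auto)
  then have int: "set_integrable lborel unit_disk (\<lambda>z. ?h z * (1 - (norm z)\<^sup>2) powr a)"
    using v_int weighted_disk_integral_strip(1)[OF c] by blast
  then show "test_fun a e \<in> bergman_space a"
    using test_fun_holomorphic by (simp add: bergman_space_def)
  have "(LINT z:unit_disk|lborel. ?h z * (1 - (norm z)\<^sup>2) powr a) = (LINT \<zeta>:strip|lborel. ?v \<zeta> * cos (Im \<zeta>) powr a) / 4"
    unfolding weighted_disk_integral_strip(2)[OF c int]
    by (intro arg_cong2[where f = "(/)"] set_lebesgue_integral_cong sm) (use cong in auto)
  also have "\<dots> \<le> (LINT \<zeta>:strip|lborel. ?u \<zeta>) / 4"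
    by (intro divide_right_mono set_integral_mono v_int u_int le) auto
  also have "(LINT \<zeta>:strip|lborel. ?u \<zeta>) = 4 powr (2 * e) * (1 / e) * cos_integral a"
    using pr(2) E(2) by simp
  finally have "(a + 1) / pi * (LINT z:unit_disk|lborel. ?h z * (1 - (norm z)\<^sup>2) powr a) \<le>
      (a + 1) / pi * (4 powr (2 * e) * (1 / e) * cos_integral a / 4)"
    using a by (intro mult_left_mono) auto
  then show "(bergman_norm a (test_fun a e))\<^sup>2 \<le> (a + 1) / (4 * pi) * (4 powr (2 * e) * (1 / e) * cos_integral a)"
    unfolding bergman_norm_sq[OF a] by simp
qed

text \<open>
  Only the part \<open>\<bar>Re \<zeta>\<bar> \<ge> T\<close> of the strip is kept, where \<open>P\<close> is known to be large. What is lost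
  is bounded by \<open>2 T\<close>, negligible against \<open>1 / e\<close>.
\<close>

lemma test_fun_image_bergman_norm:
  fixes a e T q :: real and k :: nat
  defines "b \<equiv> a + 2 * real k"
  assumes a: "a > -1" and e: "e > 0" and T: "T \<ge> 0" and q: "q \<ge> 0"
    and P: "P holomorphic_on UNIV"
    and far: "\<And>\<zeta>. \<zeta> \<in> strip \<Longrightarrow> \<bar>Re \<zeta>\<bar> \<ge> T \<Longrightarrow> norm (P (strip_map \<zeta>)) \<ge> q"
    and mem: "(\<lambda>z. - P z / (1 - z\<^sup>2) ^ k * test_fun a e z) \<in> bergman_space b"
  shows "(bergman_norm b (\<lambda>z. - P z / (1 - z\<^sup>2) ^ k * test_fun a e z))\<^sup>2 \<ge>
    (b + 1) / (4 * pi) * (q\<^sup>2 * ((1 / e - 2 * T) * cos_integral b))"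
proof -
  have b: "b > -1" unfolding b_def using a by linarith
  let ?F = "\<lambda>z. - P z / (1 - z\<^sup>2) ^ k * test_fun a e z"
  let ?h = "\<lambda>z. (norm (?F z))\<^sup>2"
  let ?v = "\<lambda>\<zeta>. (norm (P (strip_map \<zeta>)))\<^sup>2 * norm (1 - (strip_map \<zeta>)\<^sup>2) powr (2 * e)"
  let ?f = "\<lambda>s. indicator {s. \<bar>s\<bar> \<ge> T} s * exp (- (2 * e) * \<bar>s\<bar>) :: real"
  let ?u = "\<lambda>\<zeta>. q\<^sup>2 * (?f (Re \<zeta>) * cos (Im \<zeta>) powr b)"
  have hol: "?F holomorphic_on unit_disk" and int: "set_integrable lborel unit_disk (\<lambda>z. ?h z * (1 - (norm z)\<^sup>2) powr b)"
    using mem by (auto simp: bergman_space_def)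
  have c: "continuous_on unit_disk ?h"
    by (intro continuous_on_power continuous_on_norm holomorphic_on_imp_continuous_on hol)
  have sm: "strip \<in> sets lborel" using open_strip by auto
  have cong: "?h (strip_map \<zeta>) * norm (1 - (strip_map \<zeta>)\<^sup>2) powr (b + 2) * cos (Im \<zeta>) powr b = ?v \<zeta> * cos (Im \<zeta>) powr b"
    if "\<zeta> \<in> strip" for \<zeta>
    using norm_sq_test_fun_divide[OF strip_map_in_disk[OF that]] unfolding b_def by simp
  have "set_integrable lborel strip (\<lambda>\<zeta>. ?h (strip_map \<zeta>) * norm (1 - (strip_map \<zeta>)\<^sup>2) powr (b + 2) * cos (Im \<zeta>) powr b)
      \<longleftrightarrow> set_integrable lborel strip (\<lambda>\<zeta>. ?v \<zeta> * cos (Im \<zeta>) powr b)"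
    by (rule set_integrable_cong) (use cong in auto)
  then have v_int: "set_integrable lborel strip (\<lambda>\<zeta>. ?v \<zeta> * cos (Im \<zeta>) powr b)"
    using int weighted_disk_integral_strip(1)[OF c] by blast
  note E = integral_exp_minus_abs_tail[of "2 * e" T]
  have E1: "integrable lborel ?f" and E2: "(LINT s|lborel. ?f s) \<ge> 1 / e - 2 * T"
    using E e T by auto
  note pr = strip_product_integral[OF b E1]
  have u_int: "set_integrable lborel strip ?u" using pr(1) by simp
  have le: "?u \<zeta> \<le> ?v \<zeta> * cos (Im \<zeta>) powr b" if "\<zeta> \<in> strip" for \<zeta>
  proof -
    have "q\<^sup>2 * ?f (Re \<zeta>) \<le> ?v \<zeta>"
    proof (cases "\<bar>Re \<zeta>\<bar> \<ge> T")
      case True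
      then have "q\<^sup>2 \<le> (norm (P (strip_map \<zeta>)))\<^sup>2" using far[OF that] q by (intro power_mono) auto
      then show ?thesis using True strip_map_powr_bounds(2)[OF that e] by (auto intro!: mult_mono)
    qed simp
    from mult_right_mono[OF this, of "cos (Im \<zeta>) powr b"] show ?thesis by (simp add: mult.assoc)
  qed
  have C: "cos_integral b > 0" by (rule cos_integral_pos[OF b])
  have "q\<^sup>2 * ((1 / e - 2 * T) * cos_integral b) \<le> q\<^sup>2 * ((LINT s|lborel. ?f s) * cos_integral b)"
    using E2 C by (intro mult_left_mono mult_right_mono) auto
  also have "\<dots> = (LINT \<zeta>:strip|lborel. ?u \<zeta>)" using pr(2) by simp
  also have "\<dots> \<le> (LINT \<zeta>:strip|lborel. ?v \<zeta> * cos (Im \<zeta>) powr b)"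
    by (rule set_integral_mono[OF u_int v_int le])
  also have "\<dots> = (LINT \<zeta>:strip|lborel. ?h (strip_map \<zeta>) * norm (1 - (strip_map \<zeta>)\<^sup>2) powr (b + 2) * cos (Im \<zeta>) powr b)"
    by (rule set_lebesgue_integral_cong[OF sm], intro allI impI, rule cong[symmetric])
  also have "\<dots> = 4 * (LINT z:unit_disk|lborel. ?h z * (1 - (norm z)\<^sup>2) powr b)"
    unfolding weighted_disk_integral_strip(2)[OF c int] by simp
  finally have "(b + 1) / (4 * pi) * (q\<^sup>2 * ((1 / e - 2 * T) * cos_integral b)) \<le>
      (b + 1) / (4 * pi) * (4 * (LINT z:unit_disk|lborel. ?h z * (1 - (norm z)\<^sup>2) powr b))"
    using b by (intro mult_left_mono) auto
  then show ?thesis unfolding bergman_norm_sq[OF b] by simp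
qed

text \<open>
  After multiplication by \<open>e\<close> the two preceding estimates have finite limits as \<open>e\<close> tends to \<open>0\<close>
  for fixed \<open>T\<close>. Then \<open>\<delta>\<close>, and with it \<open>q = Q - \<delta>\<close>, is moved to its limit.
\<close>

lemma multiplier_constant_lower_bound:
  fixes a B Q :: real
  assumes a: "a > -1" and B: "B \<ge> 0" and Q: "Q > 0" and P: "P holomorphic_on UNIV"
    and ends: "norm (P 1) = Q" "norm (P (-1)) = Q"
    and mem: "\<And>e. e > 0 \<Longrightarrow> (\<lambda>z. - P z / (1 - z\<^sup>2) ^ k * test_fun a e z) \<in> bergman_space (a + 2 * real k)"
    and bound: "\<And>e. e > 0 \<Longrightarrow> (bergman_norm (a + 2 * real k) (\<lambda>z. - P z / (1 - z\<^sup>2) ^ k * test_fun a e z))\<^sup>2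
      \<le> B * (bergman_norm a (test_fun a e))\<^sup>2"
  shows "Q\<^sup>2 * (\<Prod>j<k. (a + 2 * real j + 3) / (a + 2 * real j + 2)) \<le> B"
proof -
  define b where "b = a + 2 * real k"
  have Pc: "continuous_on UNIV P" by (rule holomorphic_on_imp_continuous_on[OF P])
  have near: "(b + 1) * ((Q - \<delta>)\<^sup>2 * cos_integral b) \<le> B * ((a + 1) * cos_integral a)"
    if \<delta>: "0 < \<delta>" "\<delta> < Q" for \<delta>
  proof -
    obtain T where T: "T > 0" "\<And>\<zeta>. \<zeta> \<in> strip \<Longrightarrow> \<bar>Re \<zeta>\<bar> \<ge> T \<Longrightarrow> norm (P (strip_map \<zeta>)) \<ge> Q - \<delta>"
      using strip_map_near_ends[OF Pc ends \<delta>(1)] by metis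
    have eps: "(b + 1) * ((Q - \<delta>)\<^sup>2 * ((1 - 2 * T * e) * cos_integral b)) \<le> B * ((a + 1) * (4 powr (2 * e) * cos_integral a))"
      if e: "e > 0" for e
    proof -
      have "(b + 1) / (4 * pi) * ((Q - \<delta>)\<^sup>2 * ((1 / e - 2 * T) * cos_integral b)) \<le>
          (bergman_norm b (\<lambda>z. - P z / (1 - z\<^sup>2) ^ k * test_fun a e z))\<^sup>2"
        unfolding b_def by (rule test_fun_image_bergman_norm[OF a e _ _ P T(2) mem[OF e]]) (use T \<delta> in auto)
      also have "\<dots> \<le> B * (bergman_norm a (test_fun a e))\<^sup>2"
        unfolding b_def by (rule bound[OF e])
      also have "\<dots> \<le> B * ((a + 1) / (4 * pi) * (4 powr (2 * e) * (1 / e) * cos_integral a))"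
        by (rule mult_left_mono[OF test_fun_bergman(2)[OF a e] B])
      finally have *: "(b + 1) / (4 * pi) * ((Q - \<delta>)\<^sup>2 * ((1 / e - 2 * T) * cos_integral b)) \<le>
         B * ((a + 1) / (4 * pi) * (4 powr (2 * e) * (1 / e) * cos_integral a))" .
      have l: "(4 * pi * e) * ((b + 1) / (4 * pi) * ((Q - \<delta>)\<^sup>2 * ((1 / e - 2 * T) * cos_integral b))) =
         (b + 1) * ((Q - \<delta>)\<^sup>2 * ((1 - 2 * T * e) * cos_integral b))"
      proof -
        have "1 / e - 2 * T = (1 - 2 * T * e) / e" using e by (simp add: field_simps)
        then show ?thesis using e by simp
      qed
      have r: "(4 * pi * e) * (B * ((a + 1) / (4 * pi) * (4 powr (2 * e) * (1 / e) * cos_integral a))) =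
         B * ((a + 1) * (4 powr (2 * e) * cos_integral a))"
        using e by simp
      have "(4 * pi * e) * ((b + 1) / (4 * pi) * ((Q - \<delta>)\<^sup>2 * ((1 / e - 2 * T) * cos_integral b))) \<le>
         (4 * pi * e) * (B * ((a + 1) / (4 * pi) * (4 powr (2 * e) * (1 / e) * cos_integral a)))"
        by (rule mult_left_mono[OF *]) (use e in auto)
      then show ?thesis unfolding l r .
    qed
    have l0: "(\<lambda>n. 1 / (real n + 1)) \<longlonglongrightarrow> 0" by real_asymp
    have "(\<lambda>n. (b + 1) * ((Q - \<delta>)\<^sup>2 * ((1 - 2 * T * (1 / (real n + 1))) * cos_integral b))) \<longlonglongrightarrow>
        (b + 1) * ((Q - \<delta>)\<^sup>2 * ((1 - 2 * T * 0) * cos_integral b))"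
      by (intro tendsto_intros l0)
    moreover have "(\<lambda>n. B * ((a + 1) * (4 powr (2 * (1 / (real n + 1))) * cos_integral a))) \<longlonglongrightarrow>
        B * ((a + 1) * (4 powr (2 * 0) * cos_integral a))"
      by (intro tendsto_intros l0) auto
    ultimately have "(b + 1) * ((Q - \<delta>)\<^sup>2 * ((1 - 2 * T * 0) * cos_integral b)) \<le> B * ((a + 1) * (4 powr (2 * 0) * cos_integral a))"
    proof (rule LIMSEQ_le, intro exI allI impI)
      fix n show "(b + 1) * ((Q - \<delta>)\<^sup>2 * ((1 - 2 * T * (1 / (real n + 1))) * cos_integral b)) \<le>
          B * ((a + 1) * (4 powr (2 * (1 / (real n + 1))) * cos_integral a))"
        by (rule eps) simp
    qed
    then show ?thesis by simp
  qed
  have l0: "(\<lambda>n. Q / (real n + 2)) \<longlonglongrightarrow> 0" by real_asymp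
  have "(\<lambda>n. (b + 1) * ((Q - Q / (real n + 2))\<^sup>2 * cos_integral b)) \<longlonglongrightarrow> (b + 1) * ((Q - 0)\<^sup>2 * cos_integral b)"
    by (intro tendsto_intros l0)
  then have "(b + 1) * ((Q - 0)\<^sup>2 * cos_integral b) \<le> B * ((a + 1) * cos_integral a)"
  proof (rule LIMSEQ_le_const2, intro exI allI impI)
    fix n show "(b + 1) * ((Q - Q / (real n + 2))\<^sup>2 * cos_integral b) \<le> B * ((a + 1) * cos_integral a)"
      using Q by (intro near) (auto simp: divide_simps)
  qed
  then have "Q\<^sup>2 * ((b + 1) * cos_integral b) \<le> B * ((a + 1) * cos_integral a)" by (simp add: mult_ac)
  also have "(b + 1) * cos_integral b = (\<Prod>j<k. (a + 2 * real j + 3) / (a + 2 * real j + 2)) * ((a + 1) * cos_integral a)"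
    unfolding b_def by (rule cos_integral_shift[OF a])
  finally have "(Q\<^sup>2 * (\<Prod>j<k. (a + 2 * real j + 3) / (a + 2 * real j + 2))) * ((a + 1) * cos_integral a) \<le> B * ((a + 1) * cos_integral a)"
    by (simp only: mult.assoc)
  moreover have "(a + 1) * cos_integral a > 0" using cos_integral_pos[OF a] a by simp
  ultimately show ?thesis by (rule mult_right_le_imp_le)
qed

theorem theorem2p1:
  fixes \<alpha> :: real and p q :: nat
  assumes "\<alpha> > -1" and "p \<ge> 1" and "q \<ge> 1"
  shows "multiplier \<alpha> (\<alpha> + 2 * real p + 2 * real q) (higher_schwarzian p q koebe) \<and>
    multiplier_norm \<alpha> (\<alpha> + 2 * real p + 2 * real q) (higher_schwarzian p q koebe) =
      sqrt ((fact (p + q - 1))\<^sup>2 / 2 ^ (2 * p + 2 * q) *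
        (Gamma (\<alpha> + 2 + 2 * real p + 2 * real q) / Gamma (\<alpha> + 2)) *
        (Gamma (\<alpha> / 2 + 1) / Gamma (\<alpha> / 2 + 1 + real p + real q))\<^sup>2)"
proof -
  define k where "k = p + q"
  define \<beta> where "\<beta> = \<alpha> + 2 * real k"
  define g where "g = higher_schwarzian p q koebe"
  define Q :: real where "Q = fact (p + q - 1)"
  define R where "R = (\<Prod>j<k. (\<alpha> + 2 * real j + 3) / (\<alpha> + 2 * real j + 2))"
  have \<beta>: "\<alpha> + 2 * real p + 2 * real q = \<beta>" "\<beta> > -1"
    unfolding \<beta>_def k_def using assms by auto
  have Q: "Q > 0" unfolding Q_def by simp
  have R: "R > 0" unfolding R_def using assms by (intro prod_pos) auto
  obtain P where P: "P holomorphic_on UNIV"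
    and gP: "\<And>z. z \<in> unit_disk \<Longrightarrow> g z = - P z / (1 - z\<^sup>2) ^ k"
    and PQ: "\<And>z. norm z \<le> 1 \<Longrightarrow> norm (P z) \<le> Q"
    and ends: "norm (P 1) = Q" "norm (P (-1)) = Q"
    using higher_schwarzian_koebe[OF assms(2,3)] unfolding Q_def k_def g_def by metis
  have const_eq: "(fact (p + q - 1))\<^sup>2 / 2 ^ (2 * p + 2 * q) *
        (Gamma (\<alpha> + 2 + 2 * real p + 2 * real q) / Gamma (\<alpha> + 2)) *
        (Gamma (\<alpha> / 2 + 1) / Gamma (\<alpha> / 2 + 1 + real p + real q))\<^sup>2 = Q\<^sup>2 * R"
    unfolding R_def Gamma_quotient_eq_prod[OF assms(1), symmetric] k_def Q_def
    by (simp add: algebra_simps)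
  have mem: "(\<lambda>z. g z * \<phi> z) \<in> bergman_space \<beta>"
    and norm_le: "bergman_norm \<beta> (\<lambda>z. g z * \<phi> z) \<le> (Q * sqrt R) * bergman_norm \<alpha> \<phi>"
    if \<phi>: "\<phi> \<in> bergman_space \<alpha>" for \<phi>
  proof -
    note d = bergman_divide_one_minus_sq_power[OF assms(1) \<phi>, of k, folded \<beta>_def R_def]
    have mP: "(\<lambda>z. - P z) holomorphic_on unit_disk"
      by (intro holomorphic_intros holomorphic_on_subset[OF P]) auto
    note m = bergman_mult_bounded[OF \<beta>(2) conjunct1[OF d] mP, of Q]
    have PQ': "norm (- P z) \<le> Q" if "z \<in> unit_disk" for z using PQ[of z] that by simp
    have eq: "g z * \<phi> z = - P z * (\<phi> z / (1 - z\<^sup>2) ^ k)" if "z \<in> unit_disk" for z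
      using gP[OF that] by simp
    note cong = bergman_cong[of "\<lambda>z. g z * \<phi> z" "\<lambda>z. - P z * (\<phi> z / (1 - z\<^sup>2) ^ k)" \<beta>, OF eq]
    show "(\<lambda>z. g z * \<phi> z) \<in> bergman_space \<beta>" using cong(1) m(1)[OF PQ'] by blast
    have "(bergman_norm \<beta> (\<lambda>z. g z * \<phi> z))\<^sup>2 \<le> Q\<^sup>2 * (bergman_norm \<beta> (\<lambda>z. \<phi> z / (1 - z\<^sup>2) ^ k))\<^sup>2"
      using m(2)[OF PQ'] cong(2) by simp
    also have "\<dots> \<le> Q\<^sup>2 * (R * (bergman_norm \<alpha> \<phi>)\<^sup>2)"
      using conjunct2[OF d] by (intro mult_left_mono) auto
    also have "\<dots> = ((Q * sqrt R) * bergman_norm \<alpha> \<phi>)\<^sup>2"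
      using R by (simp add: power_mult_distrib)
    finally show "bergman_norm \<beta> (\<lambda>z. g z * \<phi> z) \<le> (Q * sqrt R) * bergman_norm \<alpha> \<phi>"
      by (rule power2_le_imp_le) (use Q R bergman_norm_nonneg assms(1) in auto)
  qed
  have g_hol: "g holomorphic_on unit_disk"
  proof -
    have "(\<lambda>z. - P z / (1 - z\<^sup>2) ^ k) holomorphic_on unit_disk"
      using one_minus_sq_disk(1) by (intro holomorphic_intros holomorphic_on_subset[OF P]) auto
    then show ?thesis by (rule holomorphic_transform) (simp only: gP)
  qed
  have mult: "multiplier \<alpha> \<beta> g"
    unfolding multiplier_def using g_hol mem norm_le by blast
  let ?A = "{\<phi>\<in>bergman_space \<alpha>. \<exists>z\<in>unit_disk. \<phi> z \<noteq> 0}"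
  let ?r = "\<lambda>\<phi>. bergman_norm \<beta> (\<lambda>z. g z * \<phi> z) / bergman_norm \<alpha> \<phi>"
  have test: "test_fun \<alpha> e \<in> ?A" if "e > 0" for e
    using test_fun_bergman(1)[OF assms(1) that] test_fun_nonzero[of 0] by (auto intro!: bexI[of _ 0])
  \<comment> \<open>A vanishing norm in the denominator makes the quotient \<open>0\<close>.\<close>
  have r_le: "?r \<phi> \<le> Q * sqrt R" if "\<phi> \<in> ?A" for \<phi>
  proof (cases "bergman_norm \<alpha> \<phi> = 0")
    case False
    then have "bergman_norm \<alpha> \<phi> > 0" using bergman_norm_nonneg[OF assms(1), of \<phi>] by simp
    then show ?thesis using norm_le[of \<phi>] that by (simp add: divide_le_eq)
  qed (use Q R in simp)
  define S where "S = multiplier_norm \<alpha> \<beta> g"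
  have S_eq: "S = (SUP \<phi>\<in>?A. ?r \<phi>)" unfolding S_def multiplier_norm_def ..
  have "S \<le> Q * sqrt R"
    unfolding S_eq by (rule cSUP_least) (use test[of 1] r_le in auto)
  moreover have "Q * sqrt R \<le> S"
  proof -
    have up: "?r \<phi> \<le> S" if "\<phi> \<in> ?A" for \<phi>
      unfolding S_eq using that r_le by (intro cSUP_upper bdd_aboveI2[where M = "Q * sqrt R"]) auto
    have "?r (test_fun \<alpha> 1) \<ge> 0"
      using bergman_norm_nonneg[OF \<beta>(2)] bergman_norm_nonneg[OF assms(1)] by simp
    then have S0: "S \<ge> 0" using up[OF test[of 1]] by linarith
    have eq: "g z * test_fun \<alpha> e z = - P z / (1 - z\<^sup>2) ^ k * test_fun \<alpha> e z" if "z \<in> unit_disk" for z e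
      using gP[OF that] by simp
    note cong = bergman_cong[of "\<lambda>z. g z * test_fun \<alpha> e z" "\<lambda>z. - P z / (1 - z\<^sup>2) ^ k * test_fun \<alpha> e z" \<beta> for e, OF eq]
    have "Q\<^sup>2 * R \<le> S\<^sup>2"
      unfolding R_def
    proof (rule multiplier_constant_lower_bound[OF assms(1) _ Q P ends])
      fix e :: real assume e: "e > 0"
      show "(\<lambda>z. - P z / (1 - z\<^sup>2) ^ k * test_fun \<alpha> e z) \<in> bergman_space (\<alpha> + 2 * real k)"
        using mem[of "test_fun \<alpha> e"] test[OF e] cong(1) unfolding \<beta>_def by blast
      have "bergman_norm \<beta> (\<lambda>z. g z * test_fun \<alpha> e z) \<le> S * bergman_norm \<alpha> (test_fun \<alpha> e)"
      proof (cases "bergman_norm \<alpha> (test_fun \<alpha> e) = 0")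
        case True
        then show ?thesis using norm_le[of "test_fun \<alpha> e"] test[OF e] by simp
      next
        case False
        then have "bergman_norm \<alpha> (test_fun \<alpha> e) > 0"
          using bergman_norm_nonneg[OF assms(1)] by (simp add: less_le)
        then show ?thesis using up[OF test[OF e]] by (simp add: divide_le_eq)
      qed
      then have "(bergman_norm \<beta> (\<lambda>z. g z * test_fun \<alpha> e z))\<^sup>2 \<le> (S * bergman_norm \<alpha> (test_fun \<alpha> e))\<^sup>2"
        by (rule power_mono) (rule bergman_norm_nonneg[OF \<beta>(2)])
      then show "(bergman_norm (\<alpha> + 2 * real k) (\<lambda>z. - P z / (1 - z\<^sup>2) ^ k * test_fun \<alpha> e z))\<^sup>2
          \<le> S\<^sup>2 * (bergman_norm \<alpha> (test_fun \<alpha> e))\<^sup>2"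
        using cong(2)[of e] unfolding \<beta>_def by (simp add: power_mult_distrib)
    qed simp
    then have "(Q * sqrt R)\<^sup>2 \<le> S\<^sup>2" using R by (simp add: power_mult_distrib)
    then show ?thesis using S0 by (rule power2_le_imp_le)
  qed
  ultimately have "S = sqrt (Q\<^sup>2 * R)"
    using Q by (simp add: real_sqrt_mult)
  then show ?thesis using mult unfolding \<beta>(1) const_eq S_def g_def by blast
qed

end
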